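(* Let $a_9(n)$ be defined by $\sum_{n\geq 0}a_9(n)q^n=\frac{f_9f_{18}}{f_1f_2}$, where $f_k=\prod_{m\geq1}(1-q^{km})$. Define integers $m_{i,j}$ for $i,j\geq 1$ as follows: $m_{i,j}=0$ whenever $j>i$; $m_{1,1}=3$; $m_{2,1}=2$, $m_{2,2}=3^3$; $m_{3,1}=1$, $m_{3,2}=3^3$, $m_{3,3}=3^5$; and for $i\geq 4$, $m_{i,1}=0$ and for $j\geq 2$, \[m_{i,j}=9m_{i-1,j-1}+3m_{i-2,j-1}+m_{i-3,j-1}.\] Define the infinite matrix $C=(c_{i,j})_{i,j\geq1}$ by $c_{i,j}=m_{4i,\,i+j}$, and row vectors $\mathbf{Y}_\alpha=(y_{\alpha,1},y_{\alpha,2},\dots)$ by $\mathbf{Y}_0=(3,0,0,\dots)$ and $\mathbf{Y}_{\alpha+1}=\mathbf{Y}_\alpha C$. Then for each $\alpha\geq 0$, \[\sum_{n\geq0}a_9\left(3^{\alpha+1}n+3^{\alpha+1}-1\right)q^n=\sum_{i\geq1}y_{\alpha,i}\,q^{i-1}\left(\frac{f_3f_6}{f_1f_2}\right)^{4i}.\]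
   Context: $a_9(n)$ counts 9-regular cubic partitions of $n$. The products $\mathbf{Y}_\alpha C$ are finite sums since each $\mathbf{Y}_\alpha$ has finitely many nonzero entries. *)

theory Defs
  imports "HOL-Computational_Algebra.Formal_Power_Series"
begin

text \<open>f_k = prod_{m>=1} (1 - q^(k m)) as a formal power series over the rationals.
  The n-th coefficient of the infinite product equals the n-th coefficient of the
  finite product over m = 1..n (for k >= 1 the remaining factors are 1 mod q^(n+1)).\<close>
definition qf :: "nat \<Rightarrow> rat fps" where
  "qf k = Abs_fps (\<lambda>n. fps_nth (\<Prod>m\<in>{1..n}. (1 - fps_X ^ (k * m))) n)"

definition a9 :: "nat \<Rightarrow> rat" where
  "a9 n = fps_nth (qf 9 * qf 18 / (qf 1 * qf 2)) n"

text \<open>The integers m_{i,j} (indices i, j >= 1; value 0 at index 0, never used).\<close>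
fun mm :: "nat \<Rightarrow> nat \<Rightarrow> int" where
  "mm i j =
     (if i = 0 \<or> j = 0 \<or> j > i then 0
      else if i = 1 then 3
      else if i = 2 then (if j = 1 then 2 else 27)
      else if i = 3 then (if j = 1 then 1 else if j = 2 then 27 else 243)
      else if j = 1 then 0
      else 9 * mm (i - 1) (j - 1) + 3 * mm (i - 2) (j - 1) + mm (i - 3) (j - 1))"

definition cc :: "nat \<Rightarrow> nat \<Rightarrow> int" where
  "cc i j = mm (4 * i) (i + j)"

text \<open>Row vectors Y_alpha (entries indexed by i >= 1; index 0 is set to 0).
  Y_{alpha+1} = Y_alpha C, the sum ranging over the (finite) support of Y_alpha.\<close>
fun yy :: "nat \<Rightarrow> nat \<Rightarrow> int" where
  "yy 0 j = (if j = 1 then 3 else 0)"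
| "yy (Suc a) j =
     (if j = 0 then 0 else (\<Sum>i | 1 \<le> i \<and> yy a i \<noteq> 0. yy a i * cc i j))"

end

theory Submission
  imports Defs
begin

text \<open>
  Write \<open>\<zeta> = q f\<^sub>9 f\<^sub>1\<^sub>8 / (f\<^sub>1 f\<^sub>2)\<close> and \<open>T = q (f\<^sub>3 f\<^sub>6 / (f\<^sub>1 f\<^sub>2))\<^sup>4\<close>, and let \<open>S\<close> be \<open>T\<close> with \<open>q\<close> replaced
  by \<open>q\<^sup>3\<close>. Since \<open>f\<^sub>1 f\<^sub>2 = \<phi>(-q) \<psi>(q)\<close>, the 3-dissections of the two theta series give
  \<open>f\<^sub>1 f\<^sub>2 / (f\<^sub>9 f\<^sub>1\<^sub>8) = a - q - 2 b\<close>, where the exponents in \<open>a\<close> and \<open>b\<close> are 0 and 2 modulo 3 and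
  \<open>a b = q\<^sup>2\<close>. Multiplying the conjugates of this series under \<open>q \<mapsto> \<omega> q\<close>, \<open>\<omega>\<^sup>3 = 1\<close>, yields the modular
  equation \<open>\<zeta>\<^sup>3 = S (9 \<zeta>\<^sup>2 + 3 \<zeta> + 1)\<close>. Hence the part of \<open>\<zeta>\<^sup>i\<close> with exponents divisible by 3 obeys the
  recurrence of the \<open>m\<^sub>i\<^sub>,\<^sub>j\<close>, that is, it equals the sum of the \<open>m\<^sub>i\<^sub>,\<^sub>j S\<^sup>j\<close>. Because \<open>\<zeta>\<^sup>4 = S T\<close>, the same
  part of \<open>T\<^sup>i\<close> is the sum of the \<open>c\<^sub>i\<^sub>,\<^sub>j S\<^sup>j\<close>, so passing from \<open>\<alpha>\<close> to \<open>\<alpha> + 1\<close> multiplies the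
  coefficient vector by \<open>C\<close>.
\<close>

unbundle fps_syntax

section \<open>Formal infinite products\<close>

text \<open>This is congruence modulo \<open>q^n\<close>. Limits of finite products and sums are
  handled through it alone, without a topology on series.\<close>

definition fps_agree :: "nat \<Rightarrow> 'a fps \<Rightarrow> 'a fps \<Rightarrow> bool" where
  "fps_agree n f g \<longleftrightarrow> (\<forall>i<n. fps_nth f i = fps_nth g i)"

lemma fps_agree_refl [simp]: "fps_agree n f f"
  by (simp add: fps_agree_def)

lemma fps_agree_sym: "fps_agree n f g \<Longrightarrow> fps_agree n g f"
  by (simp add: fps_agree_def)

lemma fps_agree_trans [trans]: "fps_agree n f g \<Longrightarrow> fps_agree n g h \<Longrightarrow>
    fps_agree n f h"
  by (simp add: fps_agree_def)

lemma fps_agree_mono: "fps_agree n f g \<Longrightarrow> m \<le> n \<Longrightarrow> fps_agree m f g"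
  by (auto simp: fps_agree_def)

lemma fps_eq_by_agree: "(\<And>n. fps_agree n f g) \<Longrightarrow> f = g"
  by (rule fps_ext) (auto simp: fps_agree_def)

lemma fps_agree_add:
  "fps_agree n f g \<Longrightarrow> fps_agree n h k \<Longrightarrow> fps_agree n (f + h) (g + k)"
  by (simp add: fps_agree_def)

lemma fps_agree_diff:
  "fps_agree n f g \<Longrightarrow> fps_agree n h k \<Longrightarrow> fps_agree n (f - h) (g - k)"
  by (simp add: fps_agree_def)

lemma fps_agree_mult:
  fixes f g h k :: "'a::semiring_0 fps"
  assumes "fps_agree n f g" "fps_agree n h k"
  shows "fps_agree n (f * h) (g * k)"
  unfolding fps_agree_def
proof (intro allI impI)
  fix i assume "i < n"
  then show "(f * h) $ i = (g * k) $ i"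
    using assms by (auto simp: fps_mult_nth fps_agree_def intro!: sum.cong)
qed

lemma fps_agree_prod:
  fixes f g :: "'b \<Rightarrow> 'a::comm_semiring_1 fps"
  assumes "\<And>x. x \<in> A \<Longrightarrow> fps_agree n (f x) (g x)"
  shows "fps_agree n (prod f A) (prod g A)"
  using assms by (induction A rule: infinite_finite_induct) (auto intro: fps_agree_mult)

lemma fps_agree_sum:
  fixes f g :: "'b \<Rightarrow> 'a::comm_monoid_add fps"
  assumes "\<And>x. x \<in> A \<Longrightarrow> fps_agree n (f x) (g x)"
  shows "fps_agree n (sum f A) (sum g A)"
  using assms by (induction A rule: infinite_finite_induct) (auto intro: fps_agree_add)

lemma fps_agree_power:
  fixes f g :: "'a::comm_semiring_1 fps"
  shows "fps_agree n f g \<Longrightarrow> fps_agree n (f ^ k) (g ^ k)"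
  by (induction k) (auto intro: fps_agree_mult)

lemma fps_agree_mult_X_power_0:
  fixes f :: "'a::comm_ring_1 fps"
  shows "n \<le> k \<Longrightarrow> fps_agree n (f * fps_X ^ k) 0"
  by (simp add: fps_agree_def fps_X_power_mult_right_nth)

lemma fps_agree_cancel_left:
  fixes f g u :: "'a::field fps"
  assumes "fps_agree n (u * f) (u * g)" "u $ 0 \<noteq> 0"
  shows "fps_agree n f g"
proof -
  have "fps_agree n (inverse u * (u * f)) (inverse u * (u * g))"
    by (intro fps_agree_mult assms fps_agree_refl)
  with assms(2) show ?thesis
    by (simp flip: mult.assoc add: inverse_mult_eq_1)
qed

lemma fps_compose_X_power_nth:
  fixes f :: "'a::comm_ring_1 fps"
  assumes "k \<ge> 1"
  shows "(f oo fps_X ^ k) $ n = (if k dvd n then f $ (n div k) else 0)"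
proof -
  have "(f oo fps_X ^ k) $ n = (\<Sum>i = 0..n. if k * i = n then f $ i else 0)"
    unfolding fps_compose_nth by (intro sum.cong) (auto simp flip: power_mult)
  also have "\<dots> = (\<Sum>i\<in>(if k dvd n then {n div k} else {}). f $ i)"
  proof (subst sum.inter_filter[symmetric], simp, rule sum.cong)
    show "{i \<in> {0..n}. k * i = n} = (if k dvd n then {n div k} else {})"
      using assms by (auto simp: dvd_def)
  qed simp
  finally show ?thesis by simp
qed

lemma fps_agree_compose_X_power:
  fixes f g :: "'a::comm_ring_1 fps"
  assumes "fps_agree n f g" "k \<ge> 1"
  shows "fps_agree n (f oo fps_X ^ k) (g oo fps_X ^ k)"
  using assms unfolding fps_agree_def
  by (auto simp: fps_compose_X_power_nth dest: le_less_trans[OF div_le_dividend])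

lemma fps_agree_one_pm_X_power:
  fixes c :: "'a::comm_ring_1 fps"
  assumes "n \<le> k"
  shows "fps_agree n (1 + c * fps_X ^ k) 1" "fps_agree n (1 - fps_X ^ k) (1::'a fps)"
  using assms by (auto simp: fps_agree_def fps_X_power_mult_right_nth)

text \<open>The infinite product of the factors \<open>g r\<close> for \<open>r \<ge> 1\<close>, provided that \<open>g r\<close> is 1 modulo \<open>q\<^sup>r\<close>
  (\<open>near_one\<close> below); the value carries no meaning otherwise.\<close>

definition iprod :: "(nat \<Rightarrow> 'a::comm_ring_1 fps) \<Rightarrow> 'a fps" where
  "iprod g = Abs_fps (\<lambda>n. fps_nth (\<Prod>r\<in>{1..n}. g r) n)"

definition near_one :: "(nat \<Rightarrow> 'a::comm_ring_1 fps) \<Rightarrow> bool" where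
  "near_one g \<longleftrightarrow> (\<forall>r\<ge>1. fps_agree r (g r) 1)"

lemma near_oneD: "near_one g \<Longrightarrow> r \<ge> 1 \<Longrightarrow> n \<le> r
    \<Longrightarrow> fps_agree n (g r) 1"
  by (auto simp: near_one_def intro: fps_agree_mono)

lemma near_one_const [simp]: "near_one (\<lambda>_. 1)"
  by (simp add: near_one_def)

lemma near_one_mult: "near_one g \<Longrightarrow> near_one h \<Longrightarrow> near_one
    (\<lambda>r. g r * h r)"
  unfolding near_one_def using fps_agree_mult[of _ _ 1 _ 1] by fastforce

lemma near_one_if:
  "near_one g \<Longrightarrow> near_one h \<Longrightarrow> near_one (\<lambda>r. if P r then g r
      else h r)"
  by (simp add: near_one_def)

lemma near_one_reindex:
  assumes "near_one g" "\<And>r. r \<ge> 1 \<Longrightarrow> r \<le> k r"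
  shows "near_one (\<lambda>r. g (k r))"
  unfolding near_one_def
proof safe
  fix r :: nat assume "r \<ge> 1"
  with assms(2)[OF this] show "fps_agree r (g (k r)) 1"
    by (intro near_oneD[OF assms(1)]) auto
qed

lemma near_one_minus_X_power: "(\<And>r. r \<ge> 1 \<Longrightarrow> r \<le> k r) \<Longrightarrow>
    near_one (\<lambda>r. 1 - fps_X ^ k r)"
  by (auto simp: near_one_def intro: fps_agree_one_pm_X_power)

lemma near_one_plus_X_power:
  "(\<And>r. r \<ge> 1 \<Longrightarrow> r \<le> k r) \<Longrightarrow> near_one (\<lambda>r. 1 + c
      * fps_X ^ k r)"
  by (auto simp: near_one_def intro: fps_agree_one_pm_X_power)

text \<open>The factors with index above \<open>m\<close> are 1 modulo \<open>q^(m + 1)\<close>, so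
  they leave the coefficients up to \<open>m\<close> unchanged.\<close>

lemma partial_prod_agree:
  assumes "near_one g" "m \<le> n"
  shows "fps_agree (Suc m) (\<Prod>r\<in>{1..n}. g r) (\<Prod>r\<in>{1..m}. g r)"
  using assms(2)
proof (induction n rule: dec_induct)
  case (step n)
  have "fps_agree (Suc m) ((\<Prod>r\<in>{1..n}. g r) * g (Suc n)) ((\<Prod>r\<in>{1..m}. g r) * 1)"
    using step by (intro fps_agree_mult near_oneD[OF assms(1)]) auto
  then show ?case by simp
qed simp

lemma iprod_agree:
  assumes "near_one g" "n \<le> m"
  shows "fps_agree (Suc n) (iprod g) (\<Prod>r\<in>{1..m}. g r)"
  unfolding fps_agree_def
proof safe
  fix i assume "i < Suc n"
  with partial_prod_agree[OF assms(1), of i m] assms(2)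
  show "iprod g $ i = (\<Prod>r\<in>{1..m}. g r) $ i"
    by (simp add: iprod_def fps_agree_def)
qed

lemma iprod_agree':
  "near_one g \<Longrightarrow> n \<le> m \<Longrightarrow> fps_agree n (iprod g)
      (\<Prod>r\<in>{1..m}. g r)"
  using fps_agree_mono[OF iprod_agree[of g n m], of n] by simp

text \<open>The cutoff \<open>m\<close> may depend on \<open>n\<close>, so products whose
  truncations have different numbers of factors can still be compared.\<close>

lemma iprod_eqI:
  assumes "near_one g" "\<And>n. \<exists>m\<ge>n. fps_agree n f (\<Prod>r\<in>{1..m}. g r)"
  shows "f = iprod g"
proof (rule fps_eq_by_agree)
  fix n
  obtain m where m: "m \<ge> n" "fps_agree n f (\<Prod>r\<in>{1..m}. g r)"
    using assms(2) by blast
  note m(2)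
  also have "fps_agree n (\<Prod>r\<in>{1..m}. g r) (iprod g)"
    by (intro fps_agree_sym[OF iprod_agree'] assms m)
  finally show "fps_agree n f (iprod g)" .
qed

lemma iprod_cong: "(\<And>r. r \<ge> 1 \<Longrightarrow> g r = h r) \<Longrightarrow> iprod g = iprod h"
  by (simp add: iprod_def)

lemma iprod_mult:
  assumes "near_one g" "near_one h"
  shows "iprod g * iprod h = iprod (\<lambda>r. g r * h r)"
proof (rule iprod_eqI)
  show "near_one (\<lambda>r. g r * h r)"
    by (intro near_one_mult assms)
  show "\<exists>m\<ge>n. fps_agree n (iprod g * iprod h) (\<Prod>r = 1..m. g r * h r)" for n
    unfolding prod.distrib
    by (intro exI[of _ n] conjI fps_agree_mult iprod_agree' assms) auto
qed

lemma iprod_nth_0 [simp]: "iprod g $ 0 = 1"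
  by (simp add: iprod_def)

text \<open>Together with \<open>iprod_mult\<close> this reduces product identities to a check of
  one index \<open>r\<close> at a time: every \<open>f_k\<close> becomes a product over all
  \<open>r\<close> with a divisibility condition.\<close>

lemma iprod_multiples:
  assumes "near_one g" "k \<ge> 1"
  shows "iprod (\<lambda>r. if k dvd r then g r else 1) = iprod (\<lambda>m. g (k * m))"
proof (rule iprod_eqI)
  show "near_one (\<lambda>m. g (k * m))"
    using assms by (auto intro!: near_one_reindex[of g "\<lambda>m. k * m"])
  let ?g = "\<lambda>r. if k dvd r then g r else 1"
  have ok: "near_one ?g"
    using assms by (intro near_one_if) auto
  show "\<exists>m\<ge>n. fps_agree n (iprod ?g) (\<Prod>r = 1..m. g (k * r))" for n
  proof (intro exI conjI)
    have "(\<Prod>m = 1..n. g (k * m)) = (\<Prod>r\<in>(\<lambda>m. k * m) ` {1..n}. g r)"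
      using assms by (subst prod.reindex) (auto simp: inj_on_def)
    also have "(\<lambda>m. k * m) ` {1..n} = {r\<in>{1..k*n}. k dvd r}"
      using assms by (auto simp: dvd_def image_iff)
    also have "(\<Prod>r\<in>\<dots>. g r) = (\<Prod>r = 1..k*n. ?g r)"
      by (simp add: prod.If_cases Int_def)
    finally show "fps_agree n (iprod ?g) (\<Prod>r = 1..n. g (k * r))"
      using iprod_agree'[OF ok, of n "k * n"] assms(2) by simp
  qed simp
qed

text \<open>The triple product yields its factors in blocks, one per period; this breaks the blocks
  up into single indices.\<close>

lemma iprod_group:
  assumes "near_one g" "k \<ge> 1"
  shows "iprod (\<lambda>r. \<Prod>j<k. g (k * r - j)) = iprod g"
proof -
  let ?g = "\<lambda>r. \<Prod>j<k. g (k * r - j)"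
  have grp: "(\<Prod>r = 1..n. ?g r) = (\<Prod>r = 1..k*n. g r)" for n
  proof (induction n)
    case (Suc n)
    have "(\<Prod>r = 1..k * Suc n. g r) = (\<Prod>r\<in>{1..k * n} \<union> {k * n<..k * Suc n}. g r)"
      by (intro prod.cong) auto
    also have "\<dots> = (\<Prod>r = 1..k*n. g r) * (\<Prod>r\<in>{k * n<..k * Suc n}. g r)"
      by (rule prod.union_disjoint) auto
    also have "(\<Prod>r\<in>{k * n<..k * Suc n}. g r) = ?g (Suc n)"
      using assms(2)
      by (intro prod.reindex_bij_witness[of _ "\<lambda>j. k * Suc n - j" "\<lambda>r. k * Suc n - r"]) auto
    finally show ?case using Suc by simp
  qed simp
  have ok: "near_one ?g"
    unfolding near_one_def
  proof safe
    fix r :: nat assume r: "r \<ge> 1"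
    have "fps_agree r (?g r) (\<Prod>j<k. 1)"
    proof (intro fps_agree_prod near_oneD[OF assms(1)])
      fix j assume "j \<in> {..<k}"
      \<comment> \<open>Since \<open>j < k\<close>, the smallest index in block \<open>r\<close> is
        \<open>k * (r - 1) + 1\<close>, which is at least \<open>r\<close>.\<close>
      have "k + (r - 1) * 1 \<le> k + (r - 1) * k"
        using assms(2) by (intro add_left_mono mult_left_mono) auto
      also have "\<dots> = k * r"
        using r by (simp add: algebra_simps flip: mult_Suc)
      finally show "r \<le> k * r - j" "1 \<le> k * r - j"
        using r \<open>j \<in> {..<k}\<close> by auto
    qed
    then show "fps_agree r (?g r) 1" by simp
  qed
  show ?thesis
  proof (rule iprod_eqI[symmetric, OF ok])
    fix n
    show "\<exists>m\<ge>n. fps_agree n (iprod g) (\<Prod>r = 1..m. ?g r)"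
      unfolding grp using iprod_agree'[OF assms(1), of n "k * n"] assms(2) by auto
  qed
qed

lemma iprod_compose_X_power:
  fixes g :: "nat \<Rightarrow> 'a::idom fps"
  assumes "near_one g" "k \<ge> 1"
  shows "iprod g oo fps_X ^ k = iprod (\<lambda>r. g r oo fps_X ^ k)"
proof (rule iprod_eqI)
  have *: "fps_agree r (f oo fps_X ^ k) 1" if "fps_agree r f 1" for r and f :: "'a fps"
    using fps_agree_compose_X_power[OF that assms(2)] by simp
  then show "near_one (\<lambda>r. g r oo fps_X ^ k)"
    using assms(1) by (auto simp: near_one_def)
  fix n
  have "(\<Prod>r = 1..n. g r oo fps_X ^ k) = (\<Prod>r = 1..n. g r) oo fps_X ^ k"
    using assms(2) by (subst fps_compose_prod_distrib) (auto simp: power_0_left)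
  moreover have "fps_agree n (iprod g oo fps_X ^ k) ((\<Prod>r = 1..n. g r) oo fps_X ^ k)"
    by (intro fps_agree_compose_X_power iprod_agree' assms order.refl)
  ultimately show "\<exists>m\<ge>n. fps_agree n (iprod g oo fps_X ^ k) (\<Prod>r = 1..m. g r oo fps_X ^ k)"
    by auto
qed

lemma qf_iprod:
  "qf k = iprod (\<lambda>m. 1 - fps_X ^ (k * m))"
  by (simp add: qf_def iprod_def)

lemma qf_mult_iprod:
  assumes "j \<ge> 1" "k \<ge> 1"
  shows "qf (j * k) = iprod (\<lambda>r. if k dvd r then 1 - fps_X ^ (j * r) else 1)"
  using assms by (subst iprod_multiples) (auto simp: qf_iprod mult.assoc intro!: near_one_minus_X_power)

lemma qf_dvd_iprod: "k \<ge> 1 \<Longrightarrow> qf k = iprod (\<lambda>r. if k dvd r then 1 -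
    fps_X ^ r else 1)"
  using qf_mult_iprod[of 1 k] by (simp cong: if_cong)

lemma qf_nth_0 [simp]: "qf k $ 0 = 1"
  by (simp add: qf_iprod)

lemma qf_nonzero [simp]: "qf k \<noteq> 0"
  using qf_nth_0[of k] by (metis fps_zero_nth zero_neq_one)

lemma qf_compose_X_power:
  assumes "j \<ge> 1" "k \<ge> 1"
  shows "qf k oo fps_X ^ j = qf (j * k)"
proof -
  have "(1 - fps_X ^ m) oo fps_X ^ j = (1 - fps_X ^ (j * m) :: rat fps)" for m
    using assms by (simp add: fps_compose_sub_distrib flip: fps_compose_power power_mult)
  then show ?thesis
    using assms unfolding qf_iprod
    by (subst iprod_compose_X_power) (auto intro!: near_one_minus_X_power simp: mult.assoc)
qed

section \<open>Jacobi's triple product\<close>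

fun qbinom :: "'a::comm_semiring_1 \<Rightarrow> nat \<Rightarrow> nat \<Rightarrow> 'a" where
  "qbinom p m 0 = 1"
| "qbinom p 0 (Suc k) = 0"
| "qbinom p (Suc m) (Suc k) = qbinom p m k + p ^ Suc k * qbinom p m (Suc k)"

lemma qbinom_eq_0: "m < k \<Longrightarrow> qbinom p m k = 0"
  by (induction p m k rule: qbinom.induct) auto

lemma qbinom_self [simp]: "qbinom p m m = 1"
  by (induction m) (simp_all add: qbinom_eq_0)

text \<open>The quotient formula for Gaussian binomials, cleared of denominators. The Pascal rule
  lowers either \<open>k\<close> or \<open>l\<close>, hence the induction on
  \<open>k + l\<close>.\<close>

lemma qbinom_prod:
  fixes p :: "'a::comm_ring_1"
  defines "P \<equiv> \<lambda>n::nat. \<Prod>i\<in>{1..n}. 1 - p ^ i"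
  shows "qbinom p (k + l) k * P k * P l = P (k + l)"
proof (induction "k + l" arbitrary: k l)
  case 0
  then show ?case by (simp add: P_def)
next
  case (Suc n)
  have P_Suc: "P (Suc m) = P m * (1 - p ^ Suc m)" for m
    by (simp add: P_def)
  show ?case
  proof (cases "k = 0 \<or> l = 0")
    case True
    then show ?thesis by (auto simp: P_def)
  next
    case False
    then obtain k' l' where kl: "k = Suc k'" "l = Suc l'"
      by (metis not0_implies_Suc)
    have IH1: "qbinom p (k' + l) k' * P k' * P l = P (k' + l)"
      using Suc kl by (intro Suc(1)) auto
    have IH2: "qbinom p (k + l') k * P k * P l' = P (k + l')"
      using Suc kl by (intro Suc(1)) auto
    have "qbinom p (k + l) k * P k * P l
        = (qbinom p (k' + l) k' * P k' * P l) * (1 - p ^ k)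
          + p ^ k * ((qbinom p (k + l') k * P k * P l') * (1 - p ^ l))"
      by (simp add: kl P_Suc algebra_simps del: power_Suc)
    \<comment> \<open>Both \<open>k' + l\<close> and \<open>k + l'\<close> equal
      \<open>k + l - 1\<close>, and
      \<open>(1 - p^k) + p^k (1 - p^l) = 1 - p^(k + l)\<close>.\<close>
    also have "\<dots> = P (k' + l) * (1 - p ^ (k + l))"
      unfolding IH1 IH2 by (simp add: kl algebra_simps power_add)
    also have "\<dots> = P (k + l)"
      using P_Suc[of "k' + l"] by (simp add: kl)
    finally show ?thesis .
  qed
qed

text \<open>The homogeneous form in \<open>x\<close> and \<open>y\<close> allows a power of
  \<open>q\<close> to be put for \<open>y\<close>, so that negative exponents never arise. The
  induction splits off the factor \<open>i = 0\<close> and replaces \<open>x\<close> by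
  \<open>x * p\<close>.\<close>

lemma qbinom_theorem:
  fixes p x y :: "'a::comm_semiring_1"
  shows "(\<Prod>i<m. y + x * p ^ i) = (\<Sum>k\<le>m. qbinom p m k * p ^ (k choose 2) * x ^ k * y
      ^ (m - k))"
proof (induction m arbitrary: x)
  case (Suc m)
  let ?f = "\<lambda>k. qbinom p m k * p ^ (k choose 2) * (x * p) ^ k * y ^ (m - k)"
  have "(\<Prod>i<Suc m. y + x * p ^ i) = (y + x) * (\<Prod>i<m. y + (x * p) * p ^ i)"
    by (simp add: prod.lessThan_Suc_shift mult_ac del: prod.lessThan_Suc)
  also have "\<dots> = (\<Sum>k\<le>m. y * ?f k) + (\<Sum>k\<le>m. x * ?f k)"
    by (simp only: Suc distrib_right sum_distrib_left sum.distrib)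
  also have "(\<Sum>k\<le>m. y * ?f k) = (\<Sum>k\<le>Suc m. qbinom p m k * p ^ k * p ^ (k choose
      2) * x ^ k * y ^ (Suc m - k))"
    by (simp add: qbinom_eq_0 Suc_diff_le power_mult_distrib mult_ac)
  also have "\<dots> = y ^ Suc m + (\<Sum>k\<le>m. qbinom p m (Suc k) * p ^ Suc k * p ^ (Suc k
      choose 2) * x ^ Suc k * y ^ (m - k))"
    by (subst sum.atMost_Suc_shift) (simp add: numeral_2_eq_2)
  also have "\<dots> + (\<Sum>k\<le>m. x * ?f k)
      = y ^ Suc m + (\<Sum>k\<le>m. qbinom p (Suc m) (Suc k) * p ^ (Suc k choose 2) * x ^ Suc k * y
          ^ (m - k))"
    by (simp add: sum.distrib[symmetric] distrib_right distrib_left power_mult_distrib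
          power_add numeral_2_eq_2 mult_ac add_ac)
  also have "\<dots> = (\<Sum>k\<le>Suc m. qbinom p (Suc m) k * p ^ (k choose 2) * x ^ k * y ^ (Suc m - k))"
    by (subst sum.atMost_Suc_shift) (simp add: numeral_2_eq_2)
  finally show ?case .
qed (simp add: numeral_2_eq_2)

text \<open>As \<open>k\<close> and \<open>l\<close> grow, the Gaussian binomial tends to the
  inverse of the infinite product of the \<open>1 - p^i\<close>. Modulo \<open>q^d\<close> all
  partial products of length at least \<open>d\<close> agree, so \<open>qbinom_prod\<close> gives
  the claim after cancelling one of them.\<close>

lemma qbinom_agree_one:
  fixes u :: nat
  defines "p \<equiv> (fps_X ^ u :: 'a::field fps)"
  assumes "u \<ge> 1" "d \<le> k" "d \<le> l" "d \<le> n"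
  shows "fps_agree d ((\<Prod>i = 1..n. 1 - p ^ i) * qbinom p (k + l) k) 1"
proof -
  let ?P = "\<lambda>n. \<Prod>i = 1..n. 1 - p ^ i"
  have near: "near_one (\<lambda>i. 1 - p ^ i)"
    unfolding p_def power_mult[symmetric] using assms(2) by (intro near_one_minus_X_power) auto
  have P: "fps_agree d (?P m) (?P d)" if "m \<ge> d" for m
    using fps_agree_mono[OF partial_prod_agree[OF near that]] by simp
  have "fps_agree d (?P d * (?P n * qbinom p (k + l) k)) (?P k * (?P l * qbinom p (k + l) k))"
    by (intro fps_agree_mult fps_agree_refl P[THEN fps_agree_sym] assms
          fps_agree_trans[OF P P[THEN fps_agree_sym]])
  also have "?P k * (?P l * qbinom p (k + l) k) = ?P (k + l)"
    by (subst qbinom_prod[symmetric]) (simp add: mult_ac)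
  also have "fps_agree d \<dots> (?P d * 1)"
    using P[of "k + l"] assms by simp
  finally show ?thesis
    by (rule fps_agree_cancel_left)
      (use iprod_agree[OF near, of 0 d] in \<open>simp add: fps_agree_def\<close>)
qed

text \<open>The exponent of \<open>q\<close> in the \<open>n\<close>-th term of Ramanujan's theta series \<open>f(a, b)\<close> for \<open>a = \<plusminus>q\<^sup>s\<close>
  and \<open>b = \<plusminus>q\<^sup>t\<close>.\<close>

definition theta_exponent :: "nat \<Rightarrow> nat \<Rightarrow> int \<Rightarrow> nat" where
  "theta_exponent s t n = nat ((int s * (n * (n + 1)) + int t * (n * (n - 1))) div 2)"

lemma prod_consecutive_nonneg:
  fixes n :: int
  shows "0 \<le> n * (n + 1)" "0 \<le> n * (n - 1)"
  by (auto simp: zero_le_mult_iff intro: order.trans[of _ 0])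

lemma theta_exponent_times_2:
  "2 * int (theta_exponent s t n) = int s * (n * (n + 1)) + int t * (n * (n - 1))"
proof -
  have "0 \<le> int s * (n * (n + 1)) + int t * (n * (n - 1))"
    by (intro add_nonneg_nonneg mult_nonneg_nonneg prod_consecutive_nonneg) auto
  moreover have "even (int s * (n * (n + 1)) + int t * (n * (n - 1)))"
    by simp
  ultimately show ?thesis
    unfolding theta_exponent_def by (metis dvd_mult_div_cancel nat_0_le pos_imp_zdiv_nonneg_iff
        zero_less_numeral)
qed

text \<open>The exponent is at least \<open>n * n\<close>. This bound makes each exponent occur
  finitely often and justifies truncating the bilateral sums.\<close>

lemma abs_le_theta_exponent:
  assumes "s \<ge> 1" "t \<ge> 1"
  shows "\<bar>n\<bar> \<le> int (theta_exponent s t n)"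
proof -
  have "1 * (n * (n + 1)) + 1 * (n * (n - 1)) \<le> int s * (n * (n + 1)) + int t * (n * (n - 1))"
    using assms by (intro add_mono mult_right_mono prod_consecutive_nonneg) auto
  moreover have "\<bar>n\<bar> \<le> n * n"
    using mult_right_mono[of 1 "\<bar>n\<bar>" "\<bar>n\<bar>"] by (cases "n = 0") auto
  ultimately show ?thesis
    using theta_exponent_times_2[of s t n] by (simp add: algebra_simps)
qed

lemma int_times_2_choose_2: "2 * int (k choose 2) = int k * (int k - 1)"
proof (cases k)
  case (Suc k')
  have "2 * (k choose 2) = k * (k - 1)"
    unfolding choose_two by (rule dvd_mult_div_cancel) (cases k; simp)
  from arg_cong[OF this, of int] show ?thesis
    by (simp add: Suc distrib_right)
qed simp

text \<open>The bilateral series with terms \<open>\<sigma> k * q^(e k)\<close>. An infinite fibre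
  of \<open>e\<close> would contribute 0; for theta exponents \<open>abs_le_theta_exponent\<close>
  excludes this.\<close>

definition theta_series :: "(int \<Rightarrow> 'a::comm_ring_1) \<Rightarrow> (int \<Rightarrow>
    nat) \<Rightarrow> 'a fps" where
  "theta_series \<sigma> e = Abs_fps (\<lambda>n. \<Sum>k | e k = n. \<sigma> k)"

lemma theta_series_agree:
  assumes "\<And>k. \<bar>k\<bar> \<le> int (e k)" "d \<le> n"
  shows "fps_agree d (theta_series \<sigma> e) (\<Sum>k = - int n..int n. fps_const (\<sigma> k) *
      fps_X ^ e k)"
  unfolding fps_agree_def
proof safe
  fix i assume i: "i < d"
  have sub: "{k. e k = i} \<subseteq> {- int n..int n}"
  proof
    fix k assume "k \<in> {k. e k = i}"
    with assms(1)[of k] assms(2) i show "k \<in> {- int n..int n}" by auto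
  qed
  have "(\<Sum>k = - int n..int n. fps_const (\<sigma> k) * fps_X ^ e k) $ i
      = (\<Sum>k = - int n..int n. if e k = i then \<sigma> k else 0)"
    by (auto simp: fps_sum_nth intro!: sum.cong)
  also have "\<dots> = (\<Sum>k | k \<in> {- int n..int n} \<and> e k = i. \<sigma> k)"
    by (rule sum.inter_filter[symmetric]) simp
  also have "{k. k \<in> {- int n..int n} \<and> e k = i} = {k. e k = i}"
    using sub by auto
  finally show "theta_series \<sigma> e $ i = (\<Sum>k = - int n..int n. fps_const (\<sigma> k) *
      fps_X ^ e k) $ i"
    by (simp add: theta_series_def)
qed

lemma sign_power_cong:
  fixes c :: "'a::comm_ring_1"
  assumes "c * c = 1" "even m \<longleftrightarrow> even n"
  shows "c ^ m = c ^ n"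
proof -
  have "c ^ m = (if even m then 1 else c)" for m
    using assms(1) by (auto elim!: evenE oddE simp: power_mult power2_eq_square)
  with assms(2) show ?thesis by presburger
qed

text \<open>The q-binomial theorem for the \<open>2 n\<close> factors \<open>y + p\<^sup>i\<close> with \<open>y = b p\<^sup>n\<^sup>-\<^sup>1\<close>: extracting \<open>p\<^sup>i\<close> from the
  lower half and \<open>y\<close> from the upper half leaves the two products, because \<open>a b = p\<close>.\<close>

lemma finite_jacobi_triple:
  fixes c :: "'a::field"
  assumes c: "c * c = 1" and st: "s \<ge> 1" "t \<ge> 1" and n: "n \<ge> 1"
  defines "p \<equiv> (fps_X ^ (s + t) :: 'a fps)"
  defines "\<epsilon> \<equiv> fps_const c"
  shows "(\<Prod>j<n. (1 + \<epsilon> * fps_X ^ s * p ^ j) * (1 + \<epsilon> * fps_X ^ t * p ^ j))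
    = (\<Sum>k = - int n..int n. qbinom p (2 * n) (nat (int n + k)) *
         (fps_const (c ^ nat \<bar>k\<bar>) * fps_X ^ theta_exponent s t k))"
proof -
  have eps: "\<epsilon> * \<epsilon> = 1"
    by (simp add: \<epsilon>_def c)
  define u where "u = s + t"
  define v where "v = t + u * (n - 1)"
  define y where "y = \<epsilon> * fps_X ^ v"
  \<comment> \<open>The exponent of the monomial common to both sides: it comes from
    \<open>p^(n choose 2) * y^n\<close>.\<close>
  define E where "E = u * (n choose 2) + v * n"
  have p: "p ^ i = fps_X ^ (u * i)" for i
    by (simp add: p_def u_def power_mult)
  have epsk: "\<epsilon> ^ k = fps_const (c ^ k)" for k
    by (simp add: \<epsilon>_def)

  have f1: "y + p ^ (n - 1 - j) = p ^ (n - 1 - j) * (1 + \<epsilon> * fps_X ^ t * p ^ j)" if "j < n" for j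
  proof -
    have "n - 1 - j + j = n - 1" using that by simp
    then have "v = u * (n - 1 - j) + t + u * j"
      unfolding v_def by (metis add.commute add.left_commute distrib_left)
    then show ?thesis
      by (simp add: y_def p power_add algebra_simps)
  qed
  have f2: "y + p ^ (n + j) = y * (1 + \<epsilon> * fps_X ^ s * p ^ j)" for j
  proof -
    obtain n' where n': "n = Suc n'" using n by (cases n) auto
    have *: "u * (n + j) = v + s + u * j"
      by (simp add: v_def n' u_def algebra_simps)
    have "y * (\<epsilon> * fps_X ^ s * p ^ j) = \<epsilon> * \<epsilon> * p ^ (n + j)"
      by (simp only: p y_def *) (simp only: power_add mult_ac)
    then show ?thesis
      by (simp add: eps distrib_left)
  qed
  have sum_id: "(\<Sum>j<n. n - 1 - j) = n choose 2"
  proof -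
    have "(\<Sum>j<m. j) = m choose 2" for m :: nat
      by (induction m) (auto simp: numeral_2_eq_2)
    then show ?thesis
      using sum.nat_diff_reindex[of "\<lambda>j. j" n] by simp
  qed
  have "(\<Prod>i<2*n. y + 1 * p ^ i) = (\<Prod>i\<in>{..<n} \<union> {n..<2*n}. y + p ^ i)"
    by (intro prod.cong) auto
  also have "\<dots> = (\<Prod>i<n. y + p ^ i) * (\<Prod>i\<in>{n..<2*n}. y + p ^ i)"
    by (rule prod.union_disjoint) auto
  also have "(\<Prod>i<n. y + p ^ i) = (\<Prod>j<n. y + p ^ (n - 1 - j))"
    using prod.nat_diff_reindex[of "\<lambda>i. y + p ^ i" n] by simp
  also have "(\<Prod>i\<in>{n..<2*n}. y + p ^ i) = (\<Prod>j<n. y + p ^ (n + j))"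
    by (intro prod.reindex_bij_witness[of _ "\<lambda>j. n + j" "\<lambda>i. i - n"]) auto
  also have "(\<Prod>j<n. y + p ^ (n - 1 - j)) * (\<Prod>j<n. y + p ^ (n + j))
     = p ^ (n choose 2) * y ^ n * (\<Prod>j<n. (1 + \<epsilon> * fps_X ^ s * p ^ j) * (1 +
         \<epsilon> * fps_X ^ t * p ^ j))"
  proof -
    have "(\<Prod>j<n. y + p ^ (n - 1 - j)) = (\<Prod>j<n. p ^ (n - 1 - j) * (1 + \<epsilon> *
        fps_X ^ t * p ^ j))"
      by (intro prod.cong f1) auto
    also have "\<dots> = p ^ (n choose 2) * (\<Prod>j<n. 1 + \<epsilon> * fps_X ^ t * p ^ j)"
      unfolding prod.distrib power_sum[symmetric] sum_id ..
    finally show ?thesis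
      unfolding f2 prod.distrib by (simp add: mult_ac)
  qed
  also have "p ^ (n choose 2) * y ^ n = \<epsilon> ^ n * fps_X ^ E"
    by (simp add: p y_def E_def power_mult_distrib power_add mult_ac flip: power_mult)
  finally have prod_eq: "(\<Prod>i<2*n. y + 1 * p ^ i) = \<epsilon> ^ n * fps_X ^ E *
      (\<Prod>j<n. (1 + \<epsilon> * fps_X ^ s * p ^ j) * (1 + \<epsilon> * fps_X ^ t * p ^ j))" .

  \<comment> \<open>Shifting the index by \<open>n\<close> turns the one-sided sum into a bilateral
    one. The computation is doubled and moved to the integers, avoiding halves and truncated
    subtraction.\<close>
  have exponent: "u * (k choose 2) + v * (2 * n - k) = E + theta_exponent s t (int k - int n)"
    if "k \<le> 2 * n" for k
  proof -
    have v: "int v = int t + int u * (int n - 1)"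
      using n by (simp add: v_def)
    have l: "int (2 * n - k) = 2 * int n - int k"
      using that by simp
    have "2 * int (u * (k choose 2) + v * (2 * n - k))
        = int u * (2 * int (k choose 2)) + 2 * (int v * int (2 * n - k))"
      by (simp only: of_nat_add of_nat_mult distrib_left mult.left_commute)
    also have "\<dots> = int u * (int k * (int k - 1)) +
        2 * ((int t + int u * (int n - 1)) * (2 * int n - int k))"
      by (simp only: int_times_2_choose_2 v l)
    also have "\<dots> = int u * (int n * (int n - 1)) + 2 * ((int t + int u * (int n - 1)) * int n) +
        (int s * ((int k - int n) * (int k - int n + 1)) + int t * ((int k - int n) * (int k - int n - 1)))"
      unfolding u_def of_nat_add by algebra
    also have "\<dots> = 2 * int (E + theta_exponent s t (int k - int n))"
      unfolding theta_exponent_times_2[symmetric] v[symmetric] int_times_2_choose_2[symmetric] E_def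
      by (simp only: of_nat_add of_nat_mult distrib_left mult.left_commute)
    finally have "2 * int (u * (k choose 2) + v * (2 * n - k)) =
        2 * int (E + theta_exponent s t (int k - int n))" .
    then show ?thesis
      by (simp only: mult_left_cancel of_nat_eq_iff)
  qed
  have summand: "qbinom p (2 * n) k * p ^ (k choose 2) * 1 ^ k * y ^ (2 * n - k) =
     \<epsilon> ^ n * fps_X ^ E * (qbinom p (2 * n) k *
       (fps_const (c ^ nat \<bar>int k - int n\<bar>) * fps_X ^ theta_exponent s t (int k - int n)))"
    if "k \<le> 2 * n" for k
  proof -
    have sgn: "\<epsilon> ^ (2 * n - k) = \<epsilon> ^ n * \<epsilon> ^ nat \<bar>int k - int n\<bar>"
      unfolding power_add[symmetric]
      using that by (intro sign_power_cong eps) (auto simp: even_nat_iff)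
    have "p ^ (k choose 2) * y ^ (2 * n - k)
        = \<epsilon> ^ (2 * n - k) * fps_X ^ (u * (k choose 2) + v * (2 * n - k))"
      by (simp add: p y_def power_mult_distrib power_add mult_ac flip: power_mult)
    also have "\<dots> = \<epsilon> ^ n * fps_X ^ E * (\<epsilon> ^ nat \<bar>int k - int n\<bar> *
        fps_X ^ theta_exponent s t (int k - int n))"
      unfolding exponent[OF that] sgn power_add by (simp only: mult_ac)
    finally show ?thesis
      unfolding epsk[of "nat \<bar>int k - int n\<bar>", symmetric] by (simp add: mult.assoc
          mult.left_commute)
  qed
  have "(\<Prod>i<2*n. y + 1 * p ^ i) = \<epsilon> ^ n * fps_X ^ E * (\<Sum>k\<le>2*n. qbinom p (2 * n) k *
       (fps_const (c ^ nat \<bar>int k - int n\<bar>) * fps_X ^ theta_exponent s t (int k - int n)))"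
    unfolding qbinom_theorem sum_distrib_left by (intro sum.cong summand) auto
  also have "(\<Sum>k\<le>2*n. qbinom p (2 * n) k *
       (fps_const (c ^ nat \<bar>int k - int n\<bar>) * fps_X ^ theta_exponent s t (int k - int n)))
     = (\<Sum>k = - int n..int n. qbinom p (2 * n) (nat (int n + k)) *
         (fps_const (c ^ nat \<bar>k\<bar>) * fps_X ^ theta_exponent s t k))"
    by (intro sum.reindex_bij_witness[of _ "\<lambda>k. nat (int n + k)" "\<lambda>k. int k - int n"]) auto
  finally have "\<epsilon> ^ n * fps_X ^ E * (\<Prod>j<n. (1 + \<epsilon> * fps_X ^ s * p ^ j) * (1
      + \<epsilon> * fps_X ^ t * p ^ j))
      = \<epsilon> ^ n * fps_X ^ E * (\<Sum>k = - int n..int n. qbinom p (2 * n) (nat (int n + k)) *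
         (fps_const (c ^ nat \<bar>k\<bar>) * fps_X ^ theta_exponent s t k))"
    unfolding prod_eq .
  moreover have "\<epsilon> ^ n * fps_X ^ E \<noteq> 0"
    using eps by auto
  ultimately show ?thesis
    using mult_left_cancel by blast
qed

text \<open>The condition on \<open>c\<close> allows exactly the two signs. Modulo
  \<open>q^d\<close> the finite version passes to the limit: for
  \<open>\<bar>k\<bar> \<le> d\<close> the q-binomial factor becomes 1, and all other terms vanish
  because their exponents are at least \<open>d\<close>.\<close>

theorem jacobi_triple:
  fixes c :: "'a::field"
  assumes c: "c * c = 1" and st: "s \<ge> 1" "t \<ge> 1"
  shows "theta_series (\<lambda>k. c ^ nat \<bar>k\<bar>) (theta_exponent s t)
    = iprod (\<lambda>r. (1 + fps_const c * fps_X ^ ((s + t) * r - t)) *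
        (1 + fps_const c * fps_X ^ ((s + t) * r - s)) * (1 - fps_X ^ ((s + t) * r)))"
    (is "_ = iprod ?g")
proof (rule iprod_eqI)
  have le: "r \<le> (s + t) * r - t" "r \<le> (s + t) * r - s" if r: "r \<ge> 1" for r
  proof -
    obtain r' where "r = Suc r'" using r by (cases r) auto
    moreover have "1 * r' \<le> (s + t) * r'" using st by (intro mult_right_mono) auto
    ultimately show "r \<le> (s + t) * r - t" "r \<le> (s + t) * r - s"
      using st by (auto intro: add_mono[of 1 _ r', simplified])
  qed
  show "near_one ?g"
    using le st by (intro near_one_mult near_one_plus_X_power near_one_minus_X_power) auto
  fix d :: nat
  \<comment> \<open>With this choice \<open>n + k\<close> and \<open>n - k\<close> are at least
    \<open>d\<close> whenever \<open>\<bar>k\<bar> \<le> d\<close>.\<close>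
  define n where "n = 2 * d + 1"
  define p where "p = (fps_X ^ (s + t) :: 'a fps)"
  let ?x = "\<lambda>k. fps_const (c ^ nat \<bar>k\<bar>) * fps_X ^ theta_exponent s t k"
  have p: "p ^ i = fps_X ^ ((s + t) * i)" for i
    by (simp add: p_def power_mult)
  have "(\<Prod>r = 1..n. ?g r) = (\<Prod>j<n. ?g (Suc j))"
    by (intro prod.reindex_bij_witness[of _ Suc "\<lambda>r. r - 1"]) auto
  also have "\<dots> = (\<Prod>j<n. (1 + fps_const c * fps_X ^ s * p ^ j) *
      (1 + fps_const c * fps_X ^ t * p ^ j)) * (\<Prod>j<n. 1 - p ^ Suc j)"
    by (simp add: p prod.distrib mult.assoc del: power_Suc flip: power_add)
  also have "(\<Prod>j<n. 1 - p ^ Suc j) = (\<Prod>r = 1..n. 1 - p ^ r)"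
    by (intro prod.reindex_bij_witness[of _ "\<lambda>r. r - 1" Suc]) auto
  also have "(\<Prod>j<n. (1 + fps_const c * fps_X ^ s * p ^ j) *
      (1 + fps_const c * fps_X ^ t * p ^ j)) =
      (\<Sum>k = - int n..int n. qbinom p (2 * n) (nat (int n + k)) * ?x k)"
    unfolding p_def by (rule finite_jacobi_triple) (use c st in \<open>auto simp: n_def\<close>)
  also have "\<dots> * (\<Prod>r = 1..n. 1 - p ^ r) =
      (\<Sum>k = - int n..int n. ((\<Prod>r = 1..n. 1 - p ^ r) * qbinom p (2 * n) (nat (int n +
          k))) * ?x k)"
    by (simp add: sum_distrib_right sum_distrib_left mult_ac)
  finally have eq: "(\<Prod>r = 1..n. ?g r) = \<dots>" .
  have "fps_agree d \<dots> (\<Sum>k = - int n..int n. ?x k)"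
  proof (rule fps_agree_sum)
    fix k assume k: "k \<in> {- int n..int n}"
    let ?q = "(\<Prod>r = 1..n. 1 - p ^ r) * qbinom p (2 * n) (nat (int n + k))"
    show "fps_agree d (?q * ?x k) (?x k)"
    proof (cases "\<bar>k\<bar> \<le> int d")
      case True
      have "2 * n = nat (int n + k) + nat (int n - k)"
        using k by auto
      moreover have "fps_agree d ((\<Prod>r = 1..n. 1 - p ^ r) *
          qbinom p (nat (int n + k) + nat (int n - k)) (nat (int n + k))) 1"
        unfolding p_def by (rule qbinom_agree_one) (use True st in \<open>auto simp: n_def\<close>)
      ultimately have "fps_agree d ?q 1" by simp
      from fps_agree_mult[OF this fps_agree_refl[of d "?x k"]] show ?thesis by simp
    next
      case False
      then have "d \<le> theta_exponent s t k"
        using abs_le_theta_exponent[OF st, of k] by linarith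
      then have "fps_agree d (f * ?x k) 0" for f
        unfolding mult.assoc[symmetric] by (rule fps_agree_mult_X_power_0)
      from fps_agree_trans[OF this[of ?q] fps_agree_sym[OF this[of 1]]] show ?thesis
        by simp
    qed
  qed
  also have "fps_agree d \<dots> (theta_series (\<lambda>k. c ^ nat \<bar>k\<bar>) (theta_exponent s t))"
    by (intro fps_agree_sym[OF theta_series_agree] abs_le_theta_exponent st) (simp add: n_def)
  finally have "fps_agree d (\<Prod>r = 1..n. ?g r) (theta_series (\<lambda>k. c ^ nat
      \<bar>k\<bar>) (theta_exponent s t))"
    unfolding eq[symmetric] .
  moreover have "n \<ge> d"
    by (simp add: n_def)
  ultimately show "\<exists>m\<ge>d. fps_agree d (theta_series (\<lambda>k. c ^ nat \<bar>k\<bar>)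
      (theta_exponent s t)) (\<Prod>r = 1..m. ?g r)"
    using fps_agree_sym by blast
qed

section \<open>Product formulas and the cubic norm\<close>

lemma near_one_X_powers:
  "near_one (\<lambda>r. 1 - fps_X ^ r :: 'a::comm_ring_1 fps)"
  "near_one (\<lambda>r. 1 + fps_X ^ r :: 'a::comm_ring_1 fps)"
  "k \<ge> 1 \<Longrightarrow> near_one (\<lambda>r. 1 - fps_X ^ (k * r) :: 'a::comm_ring_1 fps)"
  using near_one_plus_X_power[of "\<lambda>r. r" "1 :: 'a fps"]
  by (auto intro!: near_one_minus_X_power)

lemma near_one_power: "near_one g \<Longrightarrow> near_one (\<lambda>r. g r ^ k)"
  by (induction k) (auto intro: near_one_mult)

lemmas near_one_intros = near_one_mult near_one_if near_one_X_powers near_one_const near_one_power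

lemma iprod_mult3:
  assumes "near_one f" "near_one g" "near_one h"
  shows "iprod f * iprod g * iprod h = iprod (\<lambda>r. f r * g r * h r)"
  by (simp only: iprod_mult assms near_one_mult)

text \<open>In Ramanujan's notation, the following four series are \<open>\<phi>(-q)\<close>, \<open>\<psi>(q)\<close>, \<open>f(q\<^sup>2, q)\<close> and
  \<open>f(-q\<^sup>5, -q)\<close>.\<close>

definition phi_series :: "rat fps" where
  "phi_series = theta_series (\<lambda>k. (- 1) ^ nat \<bar>k\<bar>) (theta_exponent 1 1)"

definition psi_series :: "rat fps" where
  "psi_series = theta_series (\<lambda>k. 1 ^ nat \<bar>k\<bar>) (theta_exponent 1 3)"

definition A_series :: "rat fps" where
  "A_series = theta_series (\<lambda>k. 1 ^ nat \<bar>k\<bar>) (theta_exponent 2 1)"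

definition Omega_series :: "rat fps" where
  "Omega_series = theta_series (\<lambda>k. (- 1) ^ nat \<bar>k\<bar>) (theta_exponent 5 1)"

lemma lessThan_numerals:
  "{..<2::nat} = {0, 1}" "{..<3::nat} = {0, 1, 2}" "{..<4::nat} = {0, 1, 2, 3}"
  "{..<6::nat} = {0, 1, 2, 3, 4, 5}"
  by auto

text \<open>The triple product has period 2 here, and \<open>iprod_group\<close> splits its blocks.
  The next three lemmas do the same with periods 4, 3 and 6.\<close>

lemma phi_series_iprod:
  "phi_series = iprod (\<lambda>r. if even r then 1 - fps_X ^ r else (1 - fps_X ^ r) ^ 2)"
    (is "_ = iprod ?h")
proof -
  have "phi_series = iprod (\<lambda>r. \<Prod>j<2. ?h (2 * r - j))"
    unfolding phi_series_def
    by (subst jacobi_triple) (auto intro!: iprod_cong simp: lessThan_numerals power2_eq_square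
        mult_2 mult_2_right mult_ac
        simp flip: fps_const_neg)
  also have "\<dots> = iprod ?h"
    by (intro iprod_group near_one_intros) auto
  finally show ?thesis .
qed

lemma psi_series_iprod:
  "psi_series = iprod (\<lambda>r. if even r then if 4 dvd r then 1 - fps_X ^ r else 1 else 1 + fps_X ^ r)"
    (is "_ = iprod ?h")
proof -
  have "psi_series = iprod (\<lambda>r. \<Prod>j<4. ?h (4 * r - j))"
    unfolding psi_series_def
  proof (subst jacobi_triple, simp, simp, simp, intro iprod_cong)
    fix r :: nat assume r: "r \<ge> 1"
    have "\<not> 4 dvd 4 * r - 2"
      using r by presburger
    then show "(1 + fps_const (1::rat) * fps_X ^ ((1 + 3) * r - 3)) *
        (1 + fps_const 1 * fps_X ^ ((1 + 3) * r - 1)) * (1 - fps_X ^ ((1 + 3) * r)) =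
        (\<Prod>j<4. ?h (4 * r - j))"
      using r by (simp add: lessThan_numerals mult_ac)
  qed
  also have "\<dots> = iprod ?h"
    by (intro iprod_group near_one_intros) auto
  finally show ?thesis .
qed

lemma A_series_iprod:
  "A_series = iprod (\<lambda>r. if 3 dvd r then 1 - fps_X ^ r else 1 + fps_X ^ r)"
    (is "_ = iprod ?h")
proof -
  have "A_series = iprod (\<lambda>r. \<Prod>j<3. ?h (3 * r - j))"
    unfolding A_series_def
  proof (subst jacobi_triple, simp, simp, simp, intro iprod_cong)
    fix r :: nat assume r: "r \<ge> 1"
    obtain q where q: "r = Suc q" using r by (cases r) auto
    have "\<not> 3 dvd 3 * r - 2" "\<not> 3 dvd 3 * r - 1"
      unfolding q by (simp; presburger)+
    then show "(1 + fps_const (1::rat) * fps_X ^ ((2 + 1) * r - 1)) *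
        (1 + fps_const 1 * fps_X ^ ((2 + 1) * r - 2)) * (1 - fps_X ^ ((2 + 1) * r)) =
        (\<Prod>j<3. ?h (3 * r - j))"
      using r by (simp add: lessThan_numerals mult_ac)
  qed
  also have "\<dots> = iprod ?h"
    by (intro iprod_group near_one_intros) auto
  finally show ?thesis .
qed

lemma Omega_series_iprod:
  "Omega_series = iprod (\<lambda>r. if r mod 6 \<in> {0, 1, 5} then 1 - fps_X ^ r else 1)"
    (is "_ = iprod ?h")
proof -
  have "Omega_series = iprod (\<lambda>r. \<Prod>j<6. ?h (6 * r - j))"
    unfolding Omega_series_def
  proof (subst jacobi_triple, simp, simp, simp, intro iprod_cong)
    fix r :: nat assume r: "r \<ge> 1"
    obtain q where q: "r = Suc q" using r by (cases r) auto
    have m: "(6 * r - j) mod 6 = 6 - j" if "0 < j" "j < 6" for j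
    proof -
      have "6 * r - j = (6 - j) + 6 * q"
        using q that by simp
      with that show ?thesis by (simp only: mod_mult_self2) simp
    qed
    have "(\<Prod>j<6. ?h (6 * r - j)) = (1 - fps_X ^ (6 * r)) * ((1 - fps_X ^ (6 * r - 1)) * (1 -
        fps_X ^ (6 * r - 5)))"
      using m[of 1] m[of 2] m[of 3] m[of 4] m[of 5] by (simp add: lessThan_numerals)
    also have "\<dots> = (1 + fps_const (- 1) * fps_X ^ ((5 + 1) * r - 1)) *
        (1 + fps_const (- 1) * fps_X ^ ((5 + 1) * r - 5)) * (1 - fps_X ^ ((5 + 1) * r))"
      by (simp add: mult.commute flip: fps_const_neg)
    finally show "(1 + fps_const (- 1 :: rat) * fps_X ^ ((5 + 1) * r - 1)) *
        (1 + fps_const (- 1) * fps_X ^ ((5 + 1) * r - 5)) * (1 - fps_X ^ ((5 + 1) * r)) =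
        (\<Prod>j<6. ?h (6 * r - j))" ..
  qed
  also have "\<dots> = iprod ?h"
    by (intro iprod_group near_one_intros) auto
  finally show ?thesis .
qed

lemma phi_series_eq: "phi_series * qf 2 = qf 1 ^ 2"
proof -
  have "phi_series * qf 2 = iprod (\<lambda>r. 1 - fps_X ^ r) * iprod (\<lambda>r. 1 - fps_X ^ r)"
    unfolding phi_series_iprod qf_dvd_iprod[of 2, simplified]
    by (subst (1 2) iprod_mult)
       (auto intro!: near_one_intros iprod_cong simp: power2_eq_square)
  also have "\<dots> = qf 1 ^ 2"
    by (simp add: qf_iprod power2_eq_square)
  finally show ?thesis .
qed

text \<open>Multiplying by \<open>f_4\<close> makes the two sides agree factor by factor: it
  supplies \<open>1 - q^(2r)\<close> at even \<open>r\<close> on the left and \<open>1 - q^r\<close>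
  at multiples of 4 on the right, while odd \<open>r\<close> use
  \<open>(1 + q^r)(1 - q^r) = 1 - q^(2r)\<close>.\<close>

lemma psi_series_eq: "psi_series * qf 1 = qf 2 ^ 2"
proof -
  have four: "qf 4 = iprod (\<lambda>r. if even r then 1 - fps_X ^ (2 * r) else 1)"
             "qf 4 = iprod (\<lambda>r. if 4 dvd r then 1 - fps_X ^ r else 1)"
    using qf_mult_iprod[of 2 2] qf_dvd_iprod[of 4] by simp_all
  have two: "qf 2 = iprod (\<lambda>r. 1 - fps_X ^ (2 * r))"
            "qf 2 = iprod (\<lambda>r. if even r then 1 - fps_X ^ r else 1)"
    using qf_iprod[of 2] qf_dvd_iprod[of 2] by simp_all
  have one: "qf 1 = iprod (\<lambda>r. 1 - fps_X ^ r)"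
    by (simp add: qf_iprod)
  have sq: "1 - fps_X ^ (2 * r) = (1 - fps_X ^ r) * (1 + fps_X ^ r :: rat fps)" for r
    by (simp add: mult_2 power_add) (simp add: algebra_simps)
  have dvd: "even r" if "4 dvd r" for r :: nat
    using that by presburger
  have "psi_series * qf 1 * qf 4 = iprod (\<lambda>r.
      (if even r then if 4 dvd r then 1 - fps_X ^ r else 1 else 1 + fps_X ^ r) *
      (1 - fps_X ^ r) * (if even r then 1 - fps_X ^ (2 * r) else 1))"
    unfolding psi_series_iprod one four(1)
    by (intro iprod_mult3 near_one_intros) auto
  also have "\<dots> = iprod (\<lambda>r. (1 - fps_X ^ (2 * r)) * (if even r then 1 - fps_X ^ r else 1) *
      (if 4 dvd r then 1 - fps_X ^ r else 1))"
    by (intro iprod_cong) (use dvd in \<open>auto simp: sq mult.assoc mult.left_commute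
        mult.commute[of "1 + _" "1 - _"]\<close>)
  also have "\<dots> = iprod (\<lambda>r. 1 - fps_X ^ (2 * r)) * iprod (\<lambda>r. if even r then
      1 - fps_X ^ r else 1) *
      iprod (\<lambda>r. if 4 dvd r then 1 - fps_X ^ r else 1)"
    by (intro iprod_mult3[symmetric] near_one_intros) auto
  also have "\<dots> = qf 2 * qf 2 * qf 4"
    using two four by simp
  finally show ?thesis by (simp add: power2_eq_square)
qed

lemma phi_psi_eq: "phi_series * psi_series = qf 1 * qf 2"
proof -
  have "(phi_series * psi_series) * (qf 1 * qf 2) = (qf 1 * qf 2) * (qf 1 * qf 2)"
    using phi_series_eq psi_series_eq by algebra
  then show ?thesis by simp
qed

lemma A_Omega_eq: "A_series * Omega_series = qf 3 * qf 6"
proof -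
  \<comment> \<open>The product of \<open>e r\<close> over even \<open>r\<close> equals that of
    \<open>e (2 * r)\<close> over all \<open>r\<close>. As an auxiliary factor it supplies the
    \<open>1 - q^r\<close> that Omega lacks at even \<open>r\<close> prime to 3, so that each
    \<open>r\<close> prime to 3 yields \<open>1 - q^(2r)\<close>.\<close>
  define e :: "nat \<Rightarrow> rat fps" where "e = (\<lambda>r. if 3 dvd r then 1 else 1 - fps_X ^ r)"
  have e: "near_one e"
    unfolding e_def by (intro near_one_intros)
  have e2: "near_one (\<lambda>r. if even r then e r else 1)" "near_one (\<lambda>r. e (2 * r))"
    using near_one_reindex[OF e, of "\<lambda>r. 2 * r"] near_one_if[OF e near_one_const] by simp_all
  have E: "iprod (\<lambda>r. if even r then e r else 1) = iprod (\<lambda>r. e (2 * r))"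
    using e by (rule iprod_multiples) simp
  have E0: "iprod (\<lambda>r. e (2 * r)) \<noteq> 0"
    using iprod_nth_0[of "\<lambda>r. e (2 * r)"] by (metis fps_zero_nth zero_neq_one)
  have sq: "(1 + fps_X ^ r) * (1 - fps_X ^ r) = (1 - fps_X ^ (2 * r) :: rat fps)"
       "(1 - fps_X ^ r) * (1 + fps_X ^ r) = (1 - fps_X ^ (2 * r) :: rat fps)" for r
    by (simp_all add: mult_2 power_add) (simp_all add: algebra_simps)
  have pointwise: "(if 3 dvd r then 1 - fps_X ^ r else 1 + fps_X ^ r) *
      (if r mod 6 \<in> {0, 1, 5} then 1 - fps_X ^ r else 1) * (if even r then e r else 1)
    = (if 3 dvd r then 1 - fps_X ^ r else 1) * (if 6 dvd r then 1 - fps_X ^ r else 1) * e (2 * r)"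
    for r
  proof -
    have "r mod 6 \<in> {..<6}" by simp
    then consider "r mod 6 = 0" | "r mod 6 = 1" | "r mod 6 = 2" | "r mod 6 = 3"
        | "r mod 6 = 4" | "r mod 6 = 5"
      unfolding lessThan_numerals insert_iff empty_iff by metis
    then show ?thesis
    proof cases
      case 1
      then have "3 dvd r" "even r" "6 dvd r" "3 dvd 2 * r" by presburger+
      with 1 show ?thesis by (simp add: e_def)
    next
      case 2
      then have "\<not> 3 dvd r" "odd r" "\<not> 6 dvd r" "\<not> 3 dvd 2 * r" by presburger+
      with 2 show ?thesis by (simp add: e_def sq)
    next
      case 3
      then have "\<not> 3 dvd r" "even r" "\<not> 6 dvd r" "\<not> 3 dvd 2 * r" by presburger+
      with 3 show ?thesis by (simp add: e_def sq)
    next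
      case 4
      then have "3 dvd r" "odd r" "\<not> 6 dvd r" "3 dvd 2 * r" by presburger+
      with 4 show ?thesis by (simp add: e_def)
    next
      case 5
      then have "\<not> 3 dvd r" "even r" "\<not> 6 dvd r" "\<not> 3 dvd 2 * r" by presburger+
      with 5 show ?thesis by (simp add: e_def sq)
    next
      case 6
      then have "\<not> 3 dvd r" "odd r" "\<not> 6 dvd r" "\<not> 3 dvd 2 * r" by presburger+
      with 6 show ?thesis by (simp add: e_def sq)
    qed
  qed
  have "A_series * Omega_series * iprod (\<lambda>r. if even r then e r else 1) = iprod (\<lambda>r.
      (if 3 dvd r then 1 - fps_X ^ r else 1 + fps_X ^ r) *
      (if r mod 6 \<in> {0, 1, 5} then 1 - fps_X ^ r else 1) * (if even r then e r else 1))"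
    unfolding A_series_iprod Omega_series_iprod
    by (intro iprod_mult3 e2 near_one_intros)
  also have "\<dots> = iprod (\<lambda>r. (if 3 dvd r then 1 - fps_X ^ r else 1) *
      (if 6 dvd r then 1 - fps_X ^ r else 1) * e (2 * r))"
    unfolding pointwise ..
  also have "\<dots> = qf 3 * qf 6 * iprod (\<lambda>r. e (2 * r))"
    unfolding qf_dvd_iprod[of 3, simplified] qf_dvd_iprod[of 6, simplified]
    by (intro iprod_mult3[symmetric] e2 near_one_intros)
  finally show ?thesis
    using E0 by (simp add: E)
qed

section \<open>Splitting series by exponents modulo 3\<close>

text \<open>Exponents are kept instead of being divided by 3, so that parts of different residues
  can be added and multiplied.\<close>

definition residue_part :: "nat \<Rightarrow> rat fps \<Rightarrow> rat fps" where
  "residue_part r f = Abs_fps (\<lambda>n. if n mod 3 = r then f $ n else 0)"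

definition in_residue :: "nat \<Rightarrow> rat fps \<Rightarrow> bool" where
  "in_residue r f \<longleftrightarrow> (\<forall>n. f $ n \<noteq> 0 \<longrightarrow> n mod 3 = r)"

lemma residue_part_add: "residue_part r (f + g) = residue_part r f + residue_part r g"
  by (rule fps_ext) (simp add: residue_part_def)

lemma residue_part_diff: "residue_part r (f - g) = residue_part r f - residue_part r g"
  by (rule fps_ext) (simp add: residue_part_def)

lemma residue_part_0 [simp]: "residue_part r 0 = 0"
  by (rule fps_ext) (simp add: residue_part_def)

lemma residue_part_sum: "residue_part r (sum f A) = (\<Sum>x\<in>A. residue_part r (f x))"
  by (induction A rule: infinite_finite_induct) (auto simp: residue_part_add)

lemma in_residue_mult:
  assumes "in_residue r f" "in_residue s g" "(r + s) mod 3 = t"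
  shows "in_residue t (f * g)"
  unfolding in_residue_def
proof safe
  fix n assume "(f * g) $ n \<noteq> 0"
  then obtain i where i: "i \<le> n" "f $ i \<noteq> 0" "g $ (n - i) \<noteq> 0"
    unfolding fps_mult_nth by (metis (no_types, lifting) atLeastAtMost_iff mult_eq_0_iff sum.neutral)
  with assms have "i mod 3 = r" "(n - i) mod 3 = s"
    by (auto simp: in_residue_def)
  then have "(i + (n - i)) mod 3 = (r + s) mod 3"
    by (metis mod_add_eq)
  with i assms show "n mod 3 = t" by simp
qed

lemma in_residue_X_power: "k mod 3 = r \<Longrightarrow> in_residue r (fps_X ^ k)"
  by (auto simp: in_residue_def)

lemma in_residue_const: "in_residue 0 (fps_const c)"
  by (auto simp: in_residue_def)

lemma in_residue_uminus: "in_residue r f \<Longrightarrow> in_residue r (- f)"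
  by (auto simp: in_residue_def)

lemma in_residue_part: "in_residue r (residue_part r f)"
  by (auto simp: in_residue_def residue_part_def split: if_splits)

lemma residue_part_in_residue:
  "in_residue s f \<Longrightarrow> residue_part r f = (if r = s then f else 0)"
  by (rule fps_ext) (auto simp: in_residue_def residue_part_def)

lemma residue_parts_sum: "f = residue_part 0 f + residue_part 1 f + residue_part 2 f"
proof (rule fps_ext)
  fix n :: nat
  consider "n mod 3 = 0" | "n mod 3 = 1" | "n mod 3 = 2" by linarith
  then show "f $ n = (residue_part 0 f + residue_part 1 f + residue_part 2 f) $ n"
    by cases (simp_all add: residue_part_def)
qed

text \<open>Multiplication by a series in \<open>q^3\<close> preserves residue classes, so
  extraction is linear over such series.\<close>

lemma residue_part_mult_left:
  assumes "in_residue 0 g"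
  shows "residue_part r (g * f) = g * residue_part r f"
proof (cases "r < 3")
  case True
  have *: "residue_part q (g * residue_part s f) = (if q = s then g * residue_part s f else 0)"
    if "s < 3" for q s
    using that by (intro residue_part_in_residue in_residue_mult[OF assms in_residue_part]) auto
  have "g * f = g * residue_part 0 f + g * residue_part 1 f + g * residue_part 2 f"
    by (subst residue_parts_sum[of f]) (simp add: distrib_left)
  then have "residue_part r (g * f) = residue_part r (g * residue_part 0 f)
      + residue_part r (g * residue_part 1 f) + residue_part r (g * residue_part 2 f)"
    by (simp add: residue_part_add)
  also have "\<dots> = g * residue_part r f"
  proof -
    from True consider "r = 0" | "r = 1" | "r = 2" by linarith
    then show ?thesis
      by cases (simp_all add: *)
  qed
  finally show ?thesis .
next
  case False
  then have "residue_part r f = 0" for f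
    by (intro fps_ext) (simp add: residue_part_def)
  then show ?thesis by simp
qed

lemma residue_part_mult:
  "residue_part 0 (f * g) = residue_part 0 f * residue_part 0 g
     + residue_part 1 f * residue_part 2 g + residue_part 2 f * residue_part 1 g"
  "residue_part 1 (f * g) = residue_part 0 f * residue_part 1 g
     + residue_part 1 f * residue_part 0 g + residue_part 2 f * residue_part 2 g"
  "residue_part 2 (f * g) = residue_part 0 f * residue_part 2 g
     + residue_part 1 f * residue_part 1 g + residue_part 2 f * residue_part 0 g"
proof -
  let ?f = "\<lambda>r. residue_part r f" and ?g = "\<lambda>r. residue_part r g"
  have *: "residue_part t (?f r * ?g s) = (if t = (r + s) mod 3 then ?f r * ?g s else 0)" for r s t
    by (rule residue_part_in_residue) (auto intro: in_residue_mult in_residue_part)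
  have fg: "f * g = (?f 0 + ?f 1 + ?f 2) * (?g 0 + ?g 1 + ?g 2)"
    by (subst (1 2) residue_parts_sum) (rule refl)
  show "residue_part 0 (f * g) = ?f 0 * ?g 0 + ?f 1 * ?g 2 + ?f 2 * ?g 1"
    unfolding fg distrib_left distrib_right residue_part_add * by simp
  show "residue_part 1 (f * g) = ?f 0 * ?g 1 + ?f 1 * ?g 0 + ?f 2 * ?g 2"
    unfolding fg distrib_left distrib_right residue_part_add * by simp
  show "residue_part 2 (f * g) = ?f 0 * ?g 2 + ?f 1 * ?g 1 + ?f 2 * ?g 0"
    unfolding fg distrib_left distrib_right residue_part_add * by simp
qed

section \<open>The cubic norm\<close>

text \<open>Circulant matrices multiply by cyclic convolution of their rows, and
  \<open>a^3 + b^3 + c^3 - 3abc\<close> is their determinant.\<close>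

lemma circulant_norm_mult:
  fixes a b c x y z :: "'a::comm_ring_1"
  shows "(a*x + b*z + c*y) ^ 3 + (a*y + b*x + c*z) ^ 3 + (a*z + b*y + c*x) ^ 3
     - 3 * (a*x + b*z + c*y) * (a*y + b*x + c*z) * (a*z + b*y + c*x)
   = (a ^ 3 + b ^ 3 + c ^ 3 - 3 * a * b * c) * (x ^ 3 + y ^ 3 + z ^ 3 - 3 * x * y * z)"
  by (simp add: power3_eq_cube algebra_simps)

text \<open>The product of the conjugates \<open>f(q) f(\<omega> q) f(\<omega>\<^sup>2 q)\<close> for a primitive cube root of unity \<open>\<omega>\<close>,
  written as a circulant determinant so that no root of unity is needed.\<close>

definition norm3 :: "rat fps \<Rightarrow> rat fps" where
  "norm3 f = residue_part 0 f ^ 3 + residue_part 1 f ^ 3 + residue_part 2 f ^ 3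
     - 3 * residue_part 0 f * residue_part 1 f * residue_part 2 f"

lemma norm3_mult: "norm3 (f * g) = norm3 f * norm3 g"
  unfolding norm3_def residue_part_mult by (rule circulant_norm_mult)

lemma norm3_in_residue: "in_residue 0 f \<Longrightarrow> norm3 f = f ^ 3"
  by (simp add: norm3_def residue_part_in_residue)

lemma norm3_one: "norm3 1 = 1"
  using in_residue_const[of 1] by (simp add: norm3_in_residue)

text \<open>If 3 divides \<open>k\<close>, the three conjugates coincide; otherwise they are
  \<open>1 - \<omega>^i q^k\<close> for the three cube roots of unity, with product
  \<open>1 - q^(3k)\<close>.\<close>

lemma norm3_one_minus_X_power:
  "norm3 (1 - fps_X ^ k) = (if 3 dvd k then (1 - fps_X ^ k) ^ 3 else 1 - fps_X ^ (3 * k))"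
proof -
  have 1: "residue_part r 1 = (if r = 0 then 1 else 0)" for r
    using residue_part_in_residue[OF in_residue_const[of 1]] by simp
  have X: "residue_part r (fps_X ^ k) = (if r = k mod 3 then fps_X ^ k else 0)" for r
    by (rule residue_part_in_residue[OF in_residue_X_power]) simp
  consider "k mod 3 = 0" | "k mod 3 = 1" | "k mod 3 = 2" by linarith
  then show ?thesis
  proof cases
    case 1
    then have "in_residue 0 (1 - fps_X ^ k)"
      using in_residue_const[of 1] in_residue_X_power[OF 1] by (auto simp: in_residue_def)
    with 1 show ?thesis by (simp add: norm3_in_residue mod_eq_0_iff_dvd)
  next
    case 2
    then have "\<not> 3 dvd k" by presburger
    with 2 show ?thesis
      by (simp add: norm3_def residue_part_diff 1 X power_mult mult.commute[of 3 k])
  next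
    case 3
    then have "\<not> 3 dvd k" by presburger
    with 3 show ?thesis
      by (simp add: norm3_def residue_part_diff 1 X power_mult mult.commute[of 3 k])
  qed
qed

lemma norm3_agree: "fps_agree n f g \<Longrightarrow> fps_agree n (norm3 f) (norm3 g)"
proof -
  assume "fps_agree n f g"
  then have *: "fps_agree n (residue_part r f) (residue_part r g)" for r
    by (simp add: fps_agree_def residue_part_def)
  show ?thesis
    unfolding norm3_def
    by (intro fps_agree_add fps_agree_diff fps_agree_mult fps_agree_power * fps_agree_refl)
qed

lemma near_one_norm3: "near_one g \<Longrightarrow> near_one (\<lambda>r. norm3 (g r))"
  using norm3_agree[of _ _ 1] by (auto simp: near_one_def norm3_one)

lemma norm3_iprod:
  assumes "near_one g"
  shows "norm3 (iprod g) = iprod (\<lambda>r. norm3 (g r))"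
proof (rule iprod_eqI[OF near_one_norm3[OF assms]])
  fix n
  have "(\<Prod>r = 1..n. norm3 (g r)) = norm3 (\<Prod>r = 1..n. g r)"
    by (induction n) (simp_all add: norm3_one norm3_mult)
  then show "\<exists>m\<ge>n. fps_agree n (norm3 (iprod g)) (\<Prod>r = 1..m. norm3 (g r))"
    using norm3_agree[OF iprod_agree'[OF assms order.refl]] by auto
qed

text \<open>The indices divisible by 3 contribute \<open>f_(3k)^3\<close>. The others contribute
  \<open>f_(3k)\<close> without its factors at multiples of 3, which are exactly those of
  \<open>f_(9k)\<close>.\<close>

lemma norm3_qf:
  assumes "k \<ge> 1" "\<not> 3 dvd k"
  shows "norm3 (qf k) * qf (9 * k) = qf (3 * k) ^ 4"
proof -
  define g :: "nat \<Rightarrow> rat fps" where "g = (\<lambda>r. 1 - fps_X ^ (k * r))"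
  define h :: "nat \<Rightarrow> rat fps" where "h = (\<lambda>r. if 3 dvd r then 1 - fps_X ^ (k *
      r) else 1)"
  define h' :: "nat \<Rightarrow> rat fps" where "h' = (\<lambda>r. if 3 dvd r then 1 - fps_X ^ (3
      * k * r) else 1)"
  define g' :: "nat \<Rightarrow> rat fps" where "g' = (\<lambda>r. 1 - fps_X ^ (3 * k * r))"
  have near: "near_one g" "near_one h" "near_one h'" "near_one g'"
    unfolding g_def h_def h'_def g'_def using assms by (intro near_one_intros; simp)+
  have eqs: "qf k = iprod g" "qf (9 * k) = iprod h'" "qf (3 * k) = iprod h" "qf (3 * k) = iprod g'"
    using assms qf_mult_iprod[of "3 * k" 3] qf_mult_iprod[of k 3]
    by (simp_all add: qf_iprod g_def h'_def h_def g'_def mult_ac)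
  have cop: "3 dvd k * r \<longleftrightarrow> 3 dvd r" for r
    using assms(2) by (simp add: prime_dvd_mult_iff)
  have "norm3 (qf k) * qf (9 * k) = iprod (\<lambda>r. norm3 (g r) * h' r)"
    unfolding eqs(1,2) norm3_iprod[OF near(1)] by (intro iprod_mult near near_one_norm3)
  also have "\<dots> = iprod (\<lambda>r. h r ^ 3 * g' r)"
    by (intro iprod_cong)
       (auto simp: g_def h_def g'_def h'_def norm3_one_minus_X_power cop cop[unfolded
           mult.commute[of k]] mult_ac)
  also have "\<dots> = iprod (\<lambda>r. h r ^ 3) * iprod g'"
    by (intro iprod_mult[symmetric] near near_one_power)
  also have "iprod (\<lambda>r. h r ^ 3) = iprod h ^ 3"
    unfolding power3_eq_cube by (intro iprod_mult3[symmetric] near)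
  finally show ?thesis
    unfolding eqs(3)[symmetric] eqs(4)[symmetric] by (simp add: power3_eq_cube power4_eq_xxxx)
qed

section \<open>Three-dissections of theta series\<close>

lemma finite_exponent_fibre:
  assumes "\<And>k. \<bar>k\<bar> \<le> int (e k)"
  shows "finite {k::int. e k = n}"
proof (rule finite_subset)
  show "{k. e k = n} \<subseteq> {- int n..int n}"
  proof
    fix k assume "k \<in> {k. e k = n}"
    with assms[of k] show "k \<in> {- int n..int n}" by auto
  qed
qed simp

text \<open>The summation index is split by its residue modulo \<open>m\<close>.\<close>

lemma theta_series_dissect:
  assumes "\<And>k. \<bar>k\<bar> \<le> int (e k)" "m \<ge> 1"
  shows "theta_series \<sigma> e = (\<Sum>j<m. theta_series (\<lambda>k. \<sigma> (int m * k + int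
      j)) (\<lambda>k. e (int m * k + int j)))"
proof (rule fps_ext)
  fix n
  have fin: "finite {k. e (int m * k + int j) = n}" for j
  proof -
    have "finite ((\<lambda>k. int m * k + int j) -` {k. e k = n})"
      using assms by (intro finite_vimageI finite_exponent_fibre) (auto simp: inj_on_def)
    then show ?thesis by (simp add: vimage_def)
  qed
  have "(\<Sum>k | e k = n. \<sigma> k) = (\<Sum>(j, k)\<in>(SIGMA j:{..<m}. {k. e (int m * k + int
      j) = n}). \<sigma> (int m * k + int j))"
    using assms(2)
    by (intro sum.reindex_bij_witness[of _ "\<lambda>(j, k). int m * k + int j" "\<lambda>k. (nat
        (k mod int m), k div int m)"])
       (auto simp: nat_less_iff)
  also have "\<dots> = (\<Sum>j<m. \<Sum>k | e (int m * k + int j) = n. \<sigma> (int m * k + int j))"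
    using fin by (subst sum.Sigma) auto
  finally show "theta_series \<sigma> e $ n =
      (\<Sum>j<m. theta_series (\<lambda>k. \<sigma> (int m * k + int j)) (\<lambda>k. e (int m * k
          + int j))) $ n"
    by (simp add: theta_series_def fps_sum_nth)
qed

lemma theta_series_reindex:
  assumes "bij f"
  shows "theta_series (\<lambda>k. \<sigma> (f k)) (\<lambda>k. e (f k)) = theta_series \<sigma> e"
proof (rule fps_ext)
  fix n
  have "(\<Sum>k | e (f k) = n. \<sigma> (f k)) = (\<Sum>k | e k = n. \<sigma> k)"
    using assms by (intro sum.reindex_bij_witness[of _ "inv f" f])
      (auto simp: bij_is_inj bij_is_surj surj_f_inv_f)
  then show "theta_series (\<lambda>k. \<sigma> (f k)) (\<lambda>k. e (f k)) $ n = theta_series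
      \<sigma> e $ n"
    by (simp add: theta_series_def)
qed

lemma theta_series_uminus: "theta_series (\<lambda>k. - \<sigma> k) e = - theta_series \<sigma> e"
  by (rule fps_ext) (simp add: theta_series_def sum_negf)

lemma theta_series_shift: "theta_series \<sigma> (\<lambda>k. e k + c) = fps_X ^ c * theta_series
    \<sigma> e"
proof (rule fps_ext)
  fix n
  have "{k. e k + c = n} = (if n < c then {} else {k. e k = n - c})"
    by auto
  then show "theta_series \<sigma> (\<lambda>k. e k + c) $ n = (fps_X ^ c * theta_series \<sigma> e) $ n"
    by (simp add: theta_series_def fps_X_power_mult_nth)
qed

lemma theta_series_compose:
  assumes "m \<ge> 1"
  shows "theta_series \<sigma> (\<lambda>k. m * e k) = theta_series \<sigma> e oo fps_X ^ m"
proof (rule fps_ext)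
  fix n
  have "{k. m * e k = n} = (if m dvd n then {k. e k = n div m} else {})"
    using assms by auto
  then show "theta_series \<sigma> (\<lambda>k. m * e k) $ n = (theta_series \<sigma> e oo fps_X ^ m) $ n"
    using assms by (simp add: theta_series_def fps_compose_X_power_nth)
qed

lemma theta_exponent_eqI:
  "2 * int n = int s * (k * (k + 1)) + int t * (k * (k - 1)) \<Longrightarrow> theta_exponent s t k = n"
  using theta_exponent_times_2[of s t k] by linarith

text \<open>The exponents are the squares. Indices \<open>3k\<close> give \<open>9 k^2\<close>;
  indices \<open>3k + 1\<close> and \<open>3k + 2\<close> give the same series, exchanged by
  \<open>k \<mapsto> - k - 1\<close>, whence the factor 2.\<close>

lemma phi_series_dissect:
  "phi_series = (phi_series oo fps_X ^ 9) - 2 * fps_X * (Omega_series oo fps_X ^ 3)"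
proof -
  let ?\<sigma> = "\<lambda>k::int. (- 1 :: rat) ^ nat \<bar>k\<bar>"
  let ?e = "theta_exponent 1 1" and ?o = "theta_exponent 5 1"
  have e: "?e (3 * k) = 9 * ?e k" "?e (3 * k + 1) = 3 * ?o k + 1"
          "?e (3 * k + 2) = 3 * ?o (- k - 1) + 1" for k
    using theta_exponent_times_2[of 1 1 k] theta_exponent_times_2[of 5 1 k]
      theta_exponent_times_2[of 5 1 "- k - 1"]
    by (intro theta_exponent_eqI; simp add: algebra_simps)+
  have s: "?\<sigma> (3 * k) = ?\<sigma> k" "?\<sigma> (3 * k + 1) = - ?\<sigma> k" "?\<sigma> (3 *
      k + 2) = - ?\<sigma> (- k - 1)" for k
    unfolding minus_one_power_iff by (auto simp: even_nat_iff)
  have b: "bij (\<lambda>k::int. - k - 1)"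
    by (rule o_bij[of "\<lambda>k. - k - 1"]) (auto simp: fun_eq_iff)
  have "phi_series = theta_series ?\<sigma> (\<lambda>k. 9 * ?e k) +
      theta_series (\<lambda>k. - ?\<sigma> k) (\<lambda>k. 3 * ?o k + 1) +
      theta_series (\<lambda>k. - ?\<sigma> (- k - 1)) (\<lambda>k. 3 * ?o (- k - 1) + 1)"
    unfolding phi_series_def
    by (subst theta_series_dissect[of _ 3])
       (simp_all add: abs_le_theta_exponent lessThan_numerals s e[unfolded One_nat_def] add.assoc)
  also have "theta_series (\<lambda>k. - ?\<sigma> (- k - 1)) (\<lambda>k. 3 * ?o (- k - 1) + 1) =
      theta_series (\<lambda>k. - ?\<sigma> k) (\<lambda>k. 3 * ?o k + 1)"
    by (rule theta_series_reindex[OF b])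
  also have "theta_series (\<lambda>k. - ?\<sigma> k) (\<lambda>k. 3 * ?o k + 1) = - (fps_X *
      (Omega_series oo fps_X ^ 3))"
    by (simp only: theta_series_uminus theta_series_shift theta_series_compose Omega_series_def
        power_one_right)
  also have "theta_series ?\<sigma> (\<lambda>k. 9 * ?e k) = phi_series oo fps_X ^ 9"
    unfolding phi_series_def by (rule theta_series_compose) simp
  finally show ?thesis by (simp add: mult.assoc)
qed

text \<open>Indices \<open>3k + 1\<close> reproduce psi at \<open>q^9\<close>. Indices
  \<open>3k\<close> and \<open>3k + 2\<close> give the even and the odd terms of
  \<open>A_series\<close>, which is reassembled from its dissection modulo 2.\<close>

lemma psi_series_dissect:
  "psi_series = (A_series oo fps_X ^ 3) + fps_X * (psi_series oo fps_X ^ 9)"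
proof -
  let ?\<sigma> = "\<lambda>k::int. 1 ^ nat \<bar>k\<bar> :: rat"
  let ?e = "theta_exponent 1 3" and ?a = "theta_exponent 2 1"
  have e: "?e (3 * k) = 3 * ?a (2 * (- k) + 0)" "?e (3 * k + 1) = 9 * ?e (- k) + 1"
          "?e (3 * k + 2) = 3 * ?a (2 * k + 1)" for k
    using theta_exponent_times_2[of 1 3 "- k"] theta_exponent_times_2[of 2 1 "2 * (- k) + 0"]
      theta_exponent_times_2[of 2 1 "2 * k + 1"]
    by (intro theta_exponent_eqI; simp add: algebra_simps)+
  have "psi_series = theta_series (\<lambda>k. 1) (\<lambda>k. 3 * ?a (2 * (- k) + 0)) +
      theta_series (\<lambda>k. 1) (\<lambda>k. 9 * ?e (- k) + 1) +
      theta_series (\<lambda>k. 1) (\<lambda>k. 3 * ?a (2 * k + 1))"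
    unfolding psi_series_def
    by (subst theta_series_dissect[of _ 3])
       (simp_all add: abs_le_theta_exponent lessThan_numerals e[unfolded One_nat_def] add.assoc)
  also have "theta_series (\<lambda>k. 1) (\<lambda>k. 3 * ?a (2 * (- k) + 0)) =
      (theta_series (\<lambda>k. 1) (\<lambda>k. ?a (2 * k + 0)) oo fps_X ^ 3 :: rat fps)"
    using theta_series_reindex[OF bij_uminus, of "\<lambda>_. 1 :: rat" "\<lambda>k. ?a (2 * k + 0)"]
    by (subst theta_series_compose) auto
  also have "theta_series (\<lambda>k. 1) (\<lambda>k. 3 * ?a (2 * k + 1)) =
      (theta_series (\<lambda>k. 1) (\<lambda>k. ?a (2 * k + 1)) oo fps_X ^ 3 :: rat fps)"
    by (rule theta_series_compose) simp
  also have "theta_series (\<lambda>k. 1) (\<lambda>k. 9 * ?e (- k) + 1) = fps_X * (psi_series oo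
      fps_X ^ 9)"
    using theta_series_reindex[OF bij_uminus, of "\<lambda>_. 1 :: rat" "?e"]
    by (subst theta_series_shift, subst theta_series_compose) (auto simp: psi_series_def)
  also have "theta_series (\<lambda>k. 1) (\<lambda>k. ?a (2 * k + 0)) =
      A_series - theta_series (\<lambda>k. 1) (\<lambda>k. ?a (2 * k + 1))"
    unfolding A_series_def
    by (subst theta_series_dissect[of _ 2]) (simp_all add: abs_le_theta_exponent lessThan_numerals)
  finally show ?thesis
    by (simp add: fps_compose_sub_distrib)
qed

lemmas in_residue_mult_mod = in_residue_mult[OF _ _ refl]

lemma in_residue_compose: "3 dvd m \<Longrightarrow> m \<ge> 1 \<Longrightarrow> in_residue 0 (f oo
    fps_X ^ m)"
  by (auto simp: in_residue_def fps_compose_X_power_nth split: if_splits dest: dvd_trans)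

lemma in_residue_add: "in_residue r f \<Longrightarrow> in_residue r g \<Longrightarrow> in_residue
    r (f + g)"
  unfolding in_residue_def fps_add_nth by (metis add.right_neutral)

lemma in_residue_diff: "in_residue r f \<Longrightarrow> in_residue r g \<Longrightarrow>
    in_residue r (f - g)"
  unfolding in_residue_def fps_sub_nth by (metis diff_zero)

lemma in_residue_numeral_mult: "in_residue r f \<Longrightarrow> in_residue r (numeral k * f)"
  by (auto simp: in_residue_def numeral_fps_const)

lemma residue_part_decompose:
  assumes "in_residue 0 a" "in_residue 1 b" "in_residue 2 c"
  shows "residue_part 0 (a + b + c) = a" "residue_part 1 (a + b + c) = b"
        "residue_part 2 (a + b + c) = c"
  by (simp_all add: residue_part_add residue_part_in_residue[OF assms(1)]
      residue_part_in_residue[OF assms(2)] residue_part_in_residue[OF assms(3)])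


text \<open>For \<open>x = q\<close> and \<open>a\<close>, \<open>b\<close> with exponents 0 and 2
  modulo 3, the first identity expresses the norm of \<open>w\<close> as a polynomial in
  \<open>w\<close>; the other two sort expressions in \<open>w\<close> into residues 0, 1 and
  2.\<close>

lemma cubic_identity:
  fixes a b x w :: "'a::idom"
  assumes "a * b = x * x" "w = a + (- x) + (- (2 * b))"
  shows "w ^ 3 + 3 * x * w ^ 2 + 9 * x ^ 2 * w = a ^ 3 + (- x) ^ 3 + (- (2 * b)) ^ 3 - 3 * a * (-
      x) * (- (2 * b))"
    "x * w ^ 2 + 3 * x ^ 2 * w + 9 * x ^ 3 =
       3 * x ^ 3 + (x * a * a - 2 * (x * x * b)) + (4 * (x * b * b) + x * x * a)"
    "x ^ 2 * w = - (x ^ 3) + (- (2 * (x * x * b))) + x * x * a"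
proof -
  show "w ^ 3 + 3 * x * w ^ 2 + 9 * x ^ 2 * w = a ^ 3 + (- x) ^ 3 + (- (2 * b)) ^ 3 - 3 * a * (- x)
      * (- (2 * b))"
    using assms by algebra
  show "x * w ^ 2 + 3 * x ^ 2 * w + 9 * x ^ 3 =
       3 * x ^ 3 + (x * a * a - 2 * (x * x * b)) + (4 * (x * b * b) + x * x * a)"
    using assms by algebra
  show "x ^ 2 * w = - (x ^ 3) + (- (2 * (x * x * b))) + x * x * a"
    using assms by algebra
qed

section \<open>The modular equation and the recurrence\<close>

definition "F_series = qf 1 * qf 2"
definition "G_series = qf 9 * qf 18"
definition "H_series = qf 3 * qf 6"

lemma FGH_nth_0 [simp]: "F_series $ 0 = 1" "G_series $ 0 = 1" "H_series $ 0 = 1"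
  by (simp_all add: F_series_def G_series_def H_series_def)

lemma FGH_nonzero [simp]: "F_series \<noteq> 0" "G_series \<noteq> 0" "H_series \<noteq> 0"
  by (simp_all add: F_series_def G_series_def H_series_def)

lemma compose_X_cubed: "F_series oo fps_X ^ 3 = H_series" "H_series oo fps_X ^ 3 = G_series"
  by (simp_all add: F_series_def G_series_def H_series_def fps_compose_mult_distrib qf_compose_X_power)

lemma inverse_FGH [simp]: "F_series * inverse F_series = 1" "G_series * inverse G_series = 1"
    "H_series * inverse H_series = 1"
  by (simp_all add: inverse_mult_eq_1')

lemma inverse_compose_X_cubed:
  "inverse F_series oo fps_X ^ 3 = inverse H_series" "inverse H_series oo fps_X ^ 3 = inverse G_series"
  by (simp_all add: fps_inverse_compose compose_X_cubed)

lemma in_residue_GH: "in_residue 0 G_series" "in_residue 0 H_series" "in_residue 0 (inverse G_series)"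
    "in_residue 0 (inverse H_series)"
  using in_residue_compose[of 3 H_series] in_residue_compose[of 3 F_series]
    in_residue_compose[of 3 "inverse H_series"] in_residue_compose[of 3 "inverse F_series"]
  by (simp_all add: compose_X_cubed inverse_compose_X_cubed)

lemma norm3_F_series: "norm3 F_series * G_series = H_series ^ 4"
  using norm3_qf[of 1] norm3_qf[of 2]
  by (simp add: F_series_def G_series_def H_series_def norm3_mult power_mult_distrib mult_ac)

text \<open>\<open>w_series\<close> is \<open>q / \<zeta>\<close> and \<open>t_series\<close> is
  \<open>q^3 / S\<close>. They are units, whereas \<open>\<zeta>\<close> and \<open>S\<close> have
  constant term 0 and cannot be inverted.\<close>

definition "w_series = F_series * inverse G_series"
definition "t_series = (H_series * inverse G_series) ^ 4"
definition "zeta_series = fps_X * G_series * inverse F_series"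
definition "S_series = fps_X ^ 3 * (G_series * inverse H_series) ^ 4"

text \<open>In the product of the two dissections, both cross products \<open>?phi * ?psi\<close>
  and \<open>?A * ?O\<close> equal \<open>G_series\<close>, so the middle terms collapse to
  \<open>q - 2q = -q\<close>.\<close>

lemma w_series_dissect:
  obtains a b where "in_residue 0 a" "in_residue 2 b" "a * b = fps_X * fps_X"
    "w_series = a + (- fps_X) + (- (2 * b))"
proof -
  let ?phi = "phi_series oo fps_X ^ 9" and ?psi = "psi_series oo fps_X ^ 9"
  let ?A = "A_series oo fps_X ^ 3" and ?O = "Omega_series oo fps_X ^ 3"
  define g where "g = inverse G_series"
  define a where "a = ?phi * ?A * g"
  define b where "b = fps_X ^ 2 * ?O * ?psi * g"
  have g: "G_series * g = 1"
    by (simp add: g_def)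
  have phi_psi: "?phi * ?psi = G_series"
    by (simp add: phi_psi_eq G_series_def fps_compose_mult_distrib[symmetric] qf_compose_X_power)
       (simp add: fps_compose_mult_distrib qf_compose_X_power)
  have A_O: "?A * ?O = G_series"
    by (simp add: A_Omega_eq G_series_def fps_compose_mult_distrib[symmetric])
       (simp add: fps_compose_mult_distrib qf_compose_X_power)
  have F: "F_series = (?phi - 2 * fps_X * ?O) * (?A + fps_X * ?psi)"
    unfolding F_series_def phi_psi_eq[symmetric]
    by (subst phi_series_dissect, subst psi_series_dissect) simp
  have "w_series = ?phi * ?A * g + fps_X * (?phi * ?psi * g) - 2 * fps_X * (?A * ?O * g) - 2 * b"
    unfolding w_series_def F g_def[symmetric] b_def by algebra
  also have "\<dots> = a + (- fps_X) + (- (2 * b))"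
    unfolding phi_psi A_O g a_def by simp
  finally have w: "w_series = a + (- fps_X) + (- (2 * b))" .
  have ab: "a * b = fps_X * fps_X"
  proof -
    have "a * b = fps_X * fps_X * (?phi * ?psi * g) * (?A * ?O * g)"
      unfolding a_def b_def by algebra
    then show ?thesis
      unfolding phi_psi A_O g by simp
  qed
  have "in_residue 0 ?phi" "in_residue 0 ?A" "in_residue 0 ?O" "in_residue 0 ?psi" "in_residue 0 g"
    unfolding g_def by (auto intro!: in_residue_compose in_residue_GH)
  note res = this
  have "in_residue 0 a"
    unfolding a_def using in_residue_mult_mod[OF in_residue_mult_mod[OF res(1,2)] res(5)] by simp
  moreover have "in_residue 2 b"
    unfolding b_def
    using in_residue_mult_mod[OF in_residue_mult_mod[OF in_residue_mult_mod[OF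
        in_residue_X_power[OF refl, of 2] res(3)] res(4)] res(5)] by simp
  ultimately show ?thesis
    using that[OF _ _ ab w] by blast
qed

lemma zeta_w: "zeta_series * w_series = fps_X"
proof -
  have "zeta_series * w_series = fps_X * (F_series * inverse F_series) * (G_series * inverse G_series)"
    unfolding zeta_series_def w_series_def by (simp only: mult_ac)
  then show ?thesis by simp
qed

lemma S_t: "S_series * t_series = fps_X ^ 3"
proof -
  have "S_series * t_series = fps_X ^ 3 * ((H_series * inverse H_series) * (G_series * inverse
      G_series)) ^ 4"
    unfolding S_series_def t_series_def by (simp only: mult_ac power_mult_distrib)
  then show ?thesis by simp
qed

lemma in_residue_power: "in_residue 0 f \<Longrightarrow> in_residue 0 (f ^ n)"
  by (induction n) (use in_residue_const[of 1] in \<open>auto intro: in_residue_mult[of 0 _ 0]\<close>)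

lemma in_residue_t: "in_residue 0 t_series"
  unfolding t_series_def
  using in_residue_power[OF in_residue_mult_mod[OF in_residue_GH(2,3), simplified]] .

lemma in_residue_S: "in_residue 0 S_series"
  unfolding S_series_def
  using in_residue_mult_mod[OF in_residue_X_power[OF refl, of 3]
      in_residue_power[OF in_residue_mult_mod[OF in_residue_GH(1,4), simplified], of 4]] by simp

lemma t_series_nonzero [simp]: "t_series \<noteq> 0"
  using S_t by auto

lemma S_series_nonzero [simp]: "S_series \<noteq> 0"
  using S_t by auto

lemma norm3_w: "norm3 w_series = t_series"
proof -
  have ring: "n * i ^ 3 * g ^ 4 = n * g * (g * i) ^ 3" for n i g :: "rat fps"
    by algebra
  have "norm3 w_series = norm3 F_series * inverse G_series ^ 3"
    unfolding w_series_def by (simp add: norm3_mult norm3_in_residue in_residue_GH)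
  then have "norm3 w_series * G_series ^ 4 = norm3 F_series * G_series * (G_series * inverse G_series) ^ 3"
    by (simp only: ring)
  also have "\<dots> = H_series ^ 4"
    by (simp add: norm3_F_series)
  also have "\<dots> = t_series * G_series ^ 4"
    unfolding t_series_def power_mult_distrib[symmetric]
    by (simp add: mult.assoc mult.commute[of "inverse G_series"])
  finally show ?thesis by simp
qed

text \<open>The norm of \<open>w\<close> gives \<open>w^3 + 3 q w^2 + 9 q^2 w = t\<close>, which is
  the cubic equation after substituting \<open>w = q / \<zeta>\<close> and
  \<open>t = q^3 / S\<close>. The two residue parts are the initial values \<open>m_{1,j}\<close>
  and \<open>m_{2,j}\<close>.\<close>

lemma zeta_relations:
  "zeta_series ^ 3 = S_series * (9 * zeta_series ^ 2 + 3 * zeta_series + 1)"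
  "residue_part 0 zeta_series = 3 * S_series"
  "residue_part 0 (zeta_series ^ 2) = 2 * S_series + 27 * S_series ^ 2"
proof -
  obtain a b where ab: "in_residue 0 a" "in_residue 2 b" "a * b = fps_X * fps_X"
    "w_series = a + (- fps_X) + (- (2 * b))"
    by (rule w_series_dissect)
  let ?x = "fps_X :: rat fps"
  note z = zeta_w and S = S_t
  have X: "in_residue 1 ?x"
    using in_residue_X_power[of 1 1] by simp
  have b2: "in_residue 2 (- (2 * b))"
    by (intro in_residue_uminus in_residue_numeral_mult ab)
  have cubic: "w_series ^ 3 + 3 * ?x * w_series ^ 2 + 9 * ?x ^ 2 * w_series = t_series"
  proof -
    have "norm3 w_series = a ^ 3 + (- ?x) ^ 3 + (- (2 * b)) ^ 3 - 3 * a * (- ?x) * (- (2 * b))"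
      unfolding norm3_def ab(4)
        residue_part_decompose[OF ab(1) in_residue_uminus[OF X] b2] ..
    then show ?thesis
      unfolding norm3_w cubic_identity(1)[OF ab(3,4)] by simp
  qed
  have "zeta_series ^ 3 * t_series = ?x ^ 3 * (9 * zeta_series ^ 2 + 3 * zeta_series + 1)"
    unfolding cubic[symmetric] z[symmetric] by algebra
  also have "\<dots> = S_series * (9 * zeta_series ^ 2 + 3 * zeta_series + 1) * t_series"
    unfolding S[symmetric] by (simp only: mult_ac)
  finally show "zeta_series ^ 3 = S_series * (9 * zeta_series ^ 2 + 3 * zeta_series + 1)"
    by simp
  \<comment> \<open>Multiplication by \<open>t\<close>, a series in \<open>q^3\<close>, commutes
    with the extraction and turns \<open>\<zeta>\<close> into a polynomial in \<open>q\<close> and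
    \<open>w\<close> whose residues are known.\<close>
  have z1: "zeta_series * t_series = ?x * w_series ^ 2 + 3 * ?x ^ 2 * w_series + 9 * ?x ^ 3"
    unfolding cubic[symmetric] z[symmetric] by algebra
  have z2: "zeta_series ^ 2 * t_series = ?x ^ 2 * w_series + 3 * ?x ^ 3 + 9 * ?x ^ 3 * zeta_series"
    unfolding cubic[symmetric] z[symmetric] by algebra
  have xx: "in_residue 2 (?x * ?x)"
    by (rule in_residue_mult[OF X X]) simp
  have x3: "in_residue 0 (?x ^ 3)"
    by (rule in_residue_X_power) simp
  have xxa: "in_residue 2 (?x * ?x * a)"
    by (rule in_residue_mult[OF xx ab(1)]) simp
  have xxb: "in_residue 1 (?x * ?x * b)"
    by (rule in_residue_mult[OF xx ab(2)]) simp
  have xaa: "in_residue 1 (?x * a * a)"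
    using in_residue_mult_mod[OF in_residue_mult_mod[OF X ab(1)] ab(1)] by simp
  have xbb: "in_residue 2 (?x * b * b)"
    using in_residue_mult_mod[OF in_residue_mult_mod[OF X ab(2)] ab(2)] by (simp add: numeral_2_eq_2)
  have "residue_part 0 (zeta_series * t_series) = 3 * ?x ^ 3"
    unfolding z1 cubic_identity(2)[OF ab(3,4)]
    by (rule residue_part_decompose)
       (intro in_residue_add in_residue_diff in_residue_numeral_mult x3 xaa xxb xbb xxa
          xxb[unfolded mult.assoc] xbb[unfolded mult.assoc])+
  then have "residue_part 0 zeta_series * t_series = 3 * S_series * t_series"
    using residue_part_mult_left[OF in_residue_t, of 0 zeta_series] S by (simp add: mult.commute)
  then show r1: "residue_part 0 zeta_series = 3 * S_series"
    by simp
  have "residue_part 0 (zeta_series ^ 2 * t_series) =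
      residue_part 0 (?x ^ 2 * w_series) + 3 * ?x ^ 3 + 9 * ?x ^ 3 * residue_part 0 zeta_series"
  proof -
    have "residue_part 0 (3 * ?x ^ 3) = 3 * ?x ^ 3"
      using residue_part_in_residue[OF in_residue_numeral_mult[OF x3]] by simp
    then show ?thesis
      unfolding z2 residue_part_add
      by (subst residue_part_mult_left) (auto intro: in_residue_numeral_mult x3)
  qed
  also have "residue_part 0 (?x ^ 2 * w_series) = - (?x ^ 3)"
    unfolding cubic_identity(3)[OF ab(3,4)]
    by (rule residue_part_decompose)
       (intro in_residue_uminus in_residue_numeral_mult x3 xxb xxa xxb[unfolded mult.assoc])+
  finally have "residue_part 0 (zeta_series ^ 2) * t_series = (2 * S_series + 27 * S_series ^ 2) * t_series"
    using residue_part_mult_left[OF in_residue_t, of 0 "zeta_series ^ 2"]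
    unfolding r1 S[symmetric] by (simp add: algebra_simps power2_eq_square)
  then show "residue_part 0 (zeta_series ^ 2) = 2 * S_series + 27 * S_series ^ 2"
    by simp
qed

declare mm.simps [simp del]

section \<open>The recurrence for residue parts of powers of zeta\<close>

lemma mm_eq_0: "j = 0 \<or> j > i \<Longrightarrow> mm i j = 0"
  by (subst mm.simps) auto

lemma mm_base:
  "mm 1 1 = 3" "mm 2 1 = 2" "mm 2 2 = 27" "mm 3 1 = 1" "mm 3 2 = 27" "mm 3 3 = 243"
  by (subst mm.simps; simp)+

lemma mm_1: "i \<ge> 4 \<Longrightarrow> mm i 1 = 0"
  by (subst mm.simps) auto

lemma mm_rec:
  assumes "i \<ge> 4"
  shows "mm i (Suc (Suc j)) = 9 * mm (i - 1) (Suc j) + 3 * mm (i - 2) (Suc j) + mm (i - 3) (Suc j)"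
proof (cases "Suc (Suc j) > i")
  case True
  then show ?thesis by (simp add: mm_eq_0)
next
  case False
  with assms show ?thesis by (subst mm.simps) auto
qed

text \<open>Lowering \<open>j\<close> by one lowers \<open>i\<close> by at most 3. In particular
  \<open>m_{4i,j}\<close> vanishes for \<open>j \<le> i\<close> when \<open>i\<close> is positive,
  so the residue part of \<open>\<zeta>^(4i)\<close> is divisible by
  \<open>S^(i + 1)\<close>.\<close>

lemma mm_eq_0_small: "3 * j < i \<Longrightarrow> mm i j = 0"
proof (induction i arbitrary: j rule: less_induct)
  case (less i)
  consider "j = 0" | "j = 1" | k where "j = Suc (Suc k)"
    by (metis One_nat_def not0_implies_Suc)
  then show ?case
  proof cases
    case 1
    then show ?thesis by (simp add: mm_eq_0)
  next
    case 2
    with less.prems mm_1[of i] show ?thesis by simp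
  next
    case 3
    with less.prems have "i \<ge> 4" by simp
    with 3 less.prems show ?thesis
      by (simp add: mm_rec less.IH)
  qed
qed

text \<open>The modular equation times \<open>\<zeta>^(i - 3)\<close> gives the recurrence. The free
  upper limit \<open>n\<close> lets the three preceding powers be summed over one common
  range.\<close>

lemma residue_part_zeta_power:
  assumes "i \<ge> 1" "i \<le> n"
  shows "residue_part 0 (zeta_series ^ i) = (\<Sum>j = 1..n. of_int (mm i j) * S_series ^ j)"
  using assms
proof (induction i arbitrary: n rule: less_induct)
  case (less i)
  define R where "R i n = (\<Sum>j = 1..n. of_int (mm i j) * S_series ^ j)" for i n
  have trunc: "R i n = R i m" if "i \<le> m" "m \<le> n" for i m n
    unfolding R_def using that by (intro sum.mono_neutral_right) (auto simp: mm_eq_0)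
  have z3: "zeta_series ^ (k + 3) = S_series * (9 * zeta_series ^ (k + 2) + 3 * zeta_series ^ (k +
      1) + zeta_series ^ k)" for k
    unfolding power_add[of _ k 3] zeta_relations(1) by (simp add: power_add power2_eq_square algebra_simps)
  have D: "residue_part 0 (9 * f) = 9 * residue_part 0 f" "residue_part 0 (3 * f) = 3 *
      residue_part 0 f" for f
    using residue_part_mult_left[OF in_residue_const, of 0 9 f] residue_part_mult_left[OF
        in_residue_const, of 0 3 f]
    by (simp_all add: numeral_fps_const)
  have rec: "residue_part 0 (zeta_series ^ (k + 3)) = S_series * (9 * residue_part 0 (zeta_series ^ (k + 2))
      + 3 * residue_part 0 (zeta_series ^ (k + 1)) + residue_part 0 (zeta_series ^ k))" for k
    unfolding z3 by (simp add: residue_part_mult_left[OF in_residue_S] residue_part_add D)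
  consider "i = 1" | "i = 2" | "i = 3" | "i \<ge> 4" using less.prems by linarith
  then show ?case unfolding R_def[symmetric]
  proof cases
    case 1
    then have "R i n = R 1 1" using trunc[of 1 1 n] less.prems by simp
    also have "\<dots> = 3 * S_series" using mm_base by (simp add: R_def)
    finally show "residue_part 0 (zeta_series ^ i) = R i n" using 1 zeta_relations(2) by simp
  next
    case 2
    then have "R i n = R 2 2" using trunc[of 2 2 n] less.prems by simp
    also have "{1..2::nat} = {1, 2}" by auto
    then have "R 2 2 = 2 * S_series + 27 * S_series ^ 2" using mm_base by (simp add: R_def)
    finally show "residue_part 0 (zeta_series ^ i) = R i n" using 2 zeta_relations(3) by simp
  next
    case 3
    then have "R i n = R 3 3" using trunc[of 3 3 n] less.prems by simp
    also have "{1..3::nat} = {1, 2, 3}" by auto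
    then have "R 3 3 = S_series + 27 * S_series ^ 2 + 243 * S_series ^ 3" using mm_base by (simp add: R_def)
    \<comment> \<open>Here the recurrence involves \<open>\<zeta>^0 = 1\<close>, which the induction
      does not cover; it accounts for \<open>m_{3,1} = 1\<close>.\<close>
    also have "\<dots> = residue_part 0 (zeta_series ^ 3)"
      using rec[of 0] zeta_relations residue_part_in_residue[OF in_residue_const[of 1], of 0]
      by (simp add: algebra_simps power2_eq_square power3_eq_cube)
    finally show "residue_part 0 (zeta_series ^ i) = R i n" using 3 by simp
  next
    case 4
    define k where "k = i - 3"
    have k: "i = k + 3" "k \<ge> 1" using 4 by (simp_all add: k_def)
    obtain m where m: "n = Suc m" using less.prems by (cases n) auto
    have "residue_part 0 (zeta_series ^ i) = S_series * (9 * R (k + 2) m + 3 * R (k + 1) m + R k m)"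
      unfolding k(1) rec using k less.prems m unfolding R_def by (subst (1 2 3) less.IH) auto
    also have "\<dots> = (\<Sum>j = 1..m. of_int (mm i (Suc j)) * S_series ^ Suc j)"
    proof -
      have "of_int (mm i (Suc j)) * S_series ^ Suc j = S_series * (9 * (of_int (mm (k + 2) j) *
          S_series ^ j)
         + 3 * (of_int (mm (k + 1) j) * S_series ^ j) + of_int (mm k j) * S_series ^ j)" if j: "j
             \<in> {1..m}" for j
      proof -
        obtain j' where j': "j = Suc j'" using j by (cases j) auto
        have "mm i (Suc j) = 9 * mm (k + 2) j + 3 * mm (k + 1) j + mm k j"
          using mm_rec[OF 4, of j'] by (simp add: j' k(1))
        then show ?thesis by (simp add: algebra_simps)
      qed
      then show ?thesis
        unfolding R_def by (simp add: sum_distrib_left sum.distrib distrib_left)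
    qed
    also have "\<dots> = (\<Sum>j\<in>{2..n}. of_int (mm i j) * S_series ^ j)"
      unfolding m by (intro sum.reindex_bij_witness[of _ "\<lambda>j. j - 1" Suc]) auto
    \<comment> \<open>The missing term \<open>j = 1\<close> is zero because
      \<open>m_{i,1} = 0\<close> from \<open>i = 4\<close> on.\<close>
    also have "\<dots> = R i n"
      unfolding R_def using mm_1[OF 4]
      by (intro sum.mono_neutral_left) (auto simp: not_le less_Suc_eq numeral_2_eq_2)
    finally show "residue_part 0 (zeta_series ^ i) = R i n" .
  qed
qed

section \<open>Residue parts of powers of \<open>T\<close>\<close>

definition "T_series = fps_X * (H_series * inverse F_series) ^ 4"

lemma T_compose: "T_series oo fps_X ^ 3 = S_series"
  by (simp add: T_series_def S_series_def fps_compose_mult_distrib fps_compose_power[symmetric]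
      compose_X_cubed inverse_compose_X_cubed)

lemma T_S: "T_series * S_series = zeta_series ^ 4"
proof -
  have "x * (h * f) ^ 4 * (x ^ 3 * (g * k) ^ 4) = (x * g * f) ^ 4 * (h * k) ^ 4" for x f g h k :: "rat fps"
    by algebra
  then have "T_series * S_series = zeta_series ^ 4 * (H_series * inverse H_series) ^ 4"
    unfolding T_series_def S_series_def zeta_series_def .
  then show ?thesis by simp
qed

text \<open>Multiplying by \<open>S^i\<close> turns \<open>T^i\<close> into
  \<open>\<zeta>^(4i)\<close>. The terms with \<open>j \<le> i\<close> vanish, and cancelling
  \<open>S^i\<close> shifts the column index, which explains
  \<open>c_{i,j} = m_{4i,i+j}\<close>.\<close>

lemma residue_part_T_power:
  assumes "i \<ge> 1" "3 * i \<le> n"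
  shows "residue_part 0 (T_series ^ i) = (\<Sum>j = 1..n. of_int (cc i j) * S_series ^ j)"
proof -
  have "residue_part 0 (T_series ^ i) * S_series ^ i = residue_part 0 ((T_series * S_series) ^ i)"
    using residue_part_mult_left[OF in_residue_power[OF in_residue_S], of 0 i "T_series ^ i"]
    by (simp add: power_mult_distrib mult.commute)
  also have "\<dots> = residue_part 0 (zeta_series ^ (4 * i))"
    by (simp add: T_S power_mult)
  also have "\<dots> = (\<Sum>j = 1..n + i. of_int (mm (4 * i) j) * S_series ^ j)"
    using assms by (intro residue_part_zeta_power) auto
  also have "\<dots> = (\<Sum>j = i + 1..n + i. of_int (mm (4 * i) j) * S_series ^ j)"
    using assms by (intro sum.mono_neutral_right) (auto simp: mm_eq_0_small)
  also have "\<dots> = (\<Sum>j = 1..n. of_int (mm (4 * i) (i + j)) * S_series ^ (i + j))"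
    by (intro sum.reindex_bij_witness[of _ "\<lambda>j. i + j" "\<lambda>j. j - i"]) auto
  also have "\<dots> = (\<Sum>j = 1..n. of_int (cc i j) * S_series ^ j) * S_series ^ i"
    unfolding cc_def sum_distrib_right power_add by (simp only: mult_ac)
  finally show ?thesis by simp
qed

section \<open>The coefficient vectors and the induction on \<open>\<alpha>\<close>\<close>

text \<open>Since \<open>c_{k,i} = 0\<close> for \<open>i > 3k\<close>, the largest index in the
  support grows at most threefold per step, starting from 1.\<close>

lemma yy_eq_0: "i = 0 \<or> i > 3 ^ a \<Longrightarrow> yy a i = 0"
proof (induction a arbitrary: i)
  case (Suc a)
  have "yy a k * cc k i = 0" if "i > 3 * 3 ^ a" for k
  proof (cases "k > 3 ^ a")
    case True
    then show ?thesis by (simp add: Suc.IH)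
  next
    case False
    with that have "k + i > 4 * k" by simp
    then show ?thesis by (simp add: cc_def mm_eq_0)
  qed
  then have "i > 3 * 3 ^ a \<Longrightarrow> (\<Sum>k | 1 \<le> k \<and> yy a k \<noteq> 0. yy a k
      * cc k i) = 0"
    by (intro sum.neutral) blast
  with Suc.prems show ?case by auto
qed auto

lemma yy_Suc:
  assumes "j \<ge> 1" "n \<ge> 3 ^ a"
  shows "yy (Suc a) j = (\<Sum>i = 1..n. yy a i * cc i j)"
proof -
  have "yy a i = 0" if "n < i" for i
    using assms(2) that by (intro yy_eq_0) linarith
  then have "{i. 1 \<le> i \<and> yy a i \<noteq> 0} \<subseteq> {1..n}"
    by (auto simp: not_less[symmetric])
  then have "(\<Sum>i | 1 \<le> i \<and> yy a i \<noteq> 0. yy a i * cc i j) = (\<Sum>i = 1..n. yy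
      a i * cc i j)"
    by (intro sum.mono_neutral_left) auto
  with assms(1) show ?thesis by simp
qed

definition a9_series :: "nat \<Rightarrow> rat fps" where
  "a9_series a = Abs_fps (\<lambda>n. a9 (3 ^ (a + 1) * n + 3 ^ (a + 1) - 1))"

text \<open>The factor \<open>q\<close> moves the exponents \<open>3n + 2\<close> to
  \<open>3n + 3\<close>, so selecting every third coefficient becomes the extraction of residue
  0.\<close>

lemma residue_part_X_mult:
  "residue_part 0 (fps_X * f) = fps_X ^ 3 * (Abs_fps (\<lambda>n. f $ (3 * n + 2)) oo fps_X ^ 3)"
proof (rule fps_ext)
  fix n :: nat
  show "residue_part 0 (fps_X * f) $ n = (fps_X ^ 3 * (Abs_fps (\<lambda>n. f $ (3 * n + 2)) oo
      fps_X ^ 3)) $ n"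
  proof (cases "3 dvd n")
    case True
    then obtain k where k: "n = 3 * k" by blast
    show ?thesis
    proof (cases k)
      case (Suc k')
      have "(3 * Suc k' - 3) div 3 = k'" by simp
      then show ?thesis
        by (simp add: k Suc residue_part_def fps_X_power_mult_nth fps_compose_X_power_nth)
    qed (simp add: k residue_part_def fps_X_power_mult_nth)
  next
    case False
    then have "\<not> 3 dvd n - 3 \<or> n < 3" by presburger
    with False show ?thesis
      by (auto simp: residue_part_def fps_X_power_mult_nth fps_compose_X_power_nth mod_eq_0_iff_dvd)
  qed
qed

lemma compose_X_cubed_inject: "f oo fps_X ^ 3 = g oo fps_X ^ 3 \<Longrightarrow> f = (g :: rat fps)"
proof (rule fps_ext)
  fix n
  assume "f oo fps_X ^ 3 = g oo fps_X ^ 3"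
  then have "(f oo fps_X ^ 3) $ (3 * n) = (g oo fps_X ^ 3) $ (3 * n)" by simp
  then show "f $ n = g $ n" by (simp add: fps_compose_X_power_nth)
qed

text \<open>Both sides are compared after \<open>q \<mapsto> q^3\<close>, where \<open>T\<close>
  becomes \<open>S\<close> and the left side becomes a residue part; the substitution is
  injective.\<close>

lemma a9_series_eq:
  assumes "n \<ge> 3 ^ a"
  shows "fps_X * a9_series a = (\<Sum>i = 1..n. of_int (yy a i) * T_series ^ i)"
  using assms
proof (induction a arbitrary: n)
  case 0
  have "fps_X * a9_series 0 oo fps_X ^ 3 = residue_part 0 zeta_series"
  proof -
    have "a9_series 0 = Abs_fps (\<lambda>n. (G_series * inverse F_series) $ (3 * n + 2))"
      by (simp add: a9_series_def a9_def fps_divide_unit F_series_def G_series_def)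
    then show ?thesis
      unfolding zeta_series_def mult.assoc residue_part_X_mult by (simp add: fps_compose_mult_distrib)
  qed
  also have "\<dots> = 3 * T_series oo fps_X ^ 3"
    by (simp add: zeta_relations(2) T_compose fps_compose_mult_distrib numeral_fps_const)
  finally have "fps_X * a9_series 0 = 3 * T_series"
    by (rule compose_X_cubed_inject)
  also have "\<dots> = (\<Sum>i\<in>{1}. of_int (yy 0 i) * T_series ^ i)"
    by simp
  also have "\<dots> = (\<Sum>i = 1..n. of_int (yy 0 i) * T_series ^ i)"
    using 0 by (intro sum.mono_neutral_left) auto
  finally show ?case .
next
  case (Suc a)
  define m :: nat where "m = 3 ^ a"
  have m: "3 * m \<le> n" using Suc.prems by (simp add: m_def)
  have c: "of_int k * f oo fps_X ^ 3 = of_int k * (f oo fps_X ^ 3 :: rat fps)" for k f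
    by (simp add: fps_compose_mult_distrib fps_of_int[symmetric])
  have D: "residue_part 0 (of_int k * f) = of_int k * residue_part 0 f" for k f
    using residue_part_mult_left[OF in_residue_const, of 0 "of_int k" f] by (simp add: fps_of_int)
  \<comment> \<open>The argument at \<open>a + 1\<close> and \<open>n\<close> is the one at
    \<open>a\<close> and \<open>3n + 2\<close>, because
    \<open>3 (n + 1) = (3n + 2) + 1\<close>.\<close>
  have "3 ^ (Suc a + 1) * n + 3 ^ (Suc a + 1) - 1 = 3 ^ (a + 1) * (3 * n + 2) + 3 ^ (a + 1) - 1"
      for n :: nat
    by (simp add: algebra_simps)
  then have "a9_series (Suc a) = Abs_fps (\<lambda>n. a9_series a $ (3 * n + 2))"
    by (simp add: a9_series_def)
  then have "fps_X * a9_series (Suc a) oo fps_X ^ 3 = residue_part 0 (fps_X * a9_series a)"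
    unfolding residue_part_X_mult by (simp add: fps_compose_mult_distrib)
  also have "\<dots> = (\<Sum>i = 1..m. of_int (yy a i) * residue_part 0 (T_series ^ i))"
    \<comment> \<open>The hypothesis is taken at the exact bound \<open>m = 3 ^ a\<close>, so that
      \<open>3 * i \<le> n\<close> holds for every \<open>i\<close> in the sum.\<close>
    unfolding Suc.IH[of m, unfolded m_def, OF order.refl, folded m_def] residue_part_sum D ..
  also have "\<dots> = (\<Sum>i = 1..m. of_int (yy a i) * (\<Sum>j = 1..n. of_int (cc i j) * S_series ^ j))"
    using m by (intro sum.cong arg_cong2[of _ _ _ _ "(*)"] residue_part_T_power) auto
  also have "\<dots> = (\<Sum>j = 1..n. \<Sum>i = 1..m. of_int (yy a i * cc i j) * S_series ^ j)"
    unfolding sum_distrib_left by (subst sum.swap) (simp add: mult.assoc)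
  also have "\<dots> = (\<Sum>j = 1..n. of_int (yy (Suc a) j) * S_series ^ j)"
  proof (intro sum.cong refl)
    fix j assume "j \<in> {1..n}"
    then have "yy (Suc a) j = (\<Sum>i = 1..m. yy a i * cc i j)"
      by (intro yy_Suc) (auto simp: m_def)
    then show "(\<Sum>i = 1..m. of_int (yy a i * cc i j) * S_series ^ j) = of_int (yy (Suc a) j) *
        S_series ^ j"
      by (simp add: sum_distrib_right)
  qed
  also have "\<dots> = (\<Sum>j = 1..n. of_int (yy (Suc a) j) * T_series ^ j) oo fps_X ^ 3"
    by (simp add: fps_compose_sum_distrib c T_compose[symmetric] fps_compose_power del: yy.simps)
  finally show ?case
    by (rule compose_X_cubed_inject)
qed

text \<open>In this coefficientwise form the sum over \<open>i\<close> stops at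
  \<open>n + 1\<close>, because the factor \<open>q^(i - 1)\<close> removes all later terms from the
  coefficient of \<open>q^n\<close>.\<close>

theorem theorem3p2:
  fixes \<alpha> :: nat
  shows "\<forall>n. a9 (3 ^ (\<alpha> + 1) * n + 3 ^ (\<alpha> + 1) - 1) =
    (\<Sum>i = 1..n + 1. of_int (yy \<alpha> i) *
       fps_nth (fps_X ^ (i - 1) * (qf 3 * qf 6 / (qf 1 * qf 2)) ^ (4 * i)) n)"
proof
  fix n :: nat
  let ?Q = "qf 3 * qf 6 / (qf 1 * qf 2)"
  \<comment> \<open>Large enough both for \<open>a9_series_eq\<close> and to contain the range up to
    \<open>n + 1\<close>.\<close>
  define N where "N = n + 1 + 3 ^ \<alpha>"
  have Q: "?Q = H_series * inverse F_series"
    by (simp add: fps_divide_unit F_series_def H_series_def)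
  have T: "(T_series ^ i) $ (n + 1) = (fps_X ^ (i - 1) * ?Q ^ (4 * i)) $ n" if "i \<ge> 1" for i
  proof -
    obtain i' where "i = Suc i'" using \<open>i \<ge> 1\<close> by (cases i) auto
    then have "T_series ^ i = fps_X * (fps_X ^ (i - 1) * ?Q ^ (4 * i))"
      unfolding T_series_def Q power_mult power_mult_distrib[of fps_X] by (simp add: mult_ac)
    then show ?thesis by simp
  qed
  have "a9 (3 ^ (\<alpha> + 1) * n + 3 ^ (\<alpha> + 1) - 1) = (fps_X * a9_series \<alpha>) $ (n + 1)"
    by (simp add: a9_series_def)
  also have "\<dots> = (\<Sum>i = 1..N. of_int (yy \<alpha> i) * (T_series ^ i) $ (n + 1))"
    by (subst a9_series_eq[of _ N]) (simp_all add: N_def fps_sum_nth fps_of_int[symmetric])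
  also have "\<dots> = (\<Sum>i = 1..N. of_int (yy \<alpha> i) * (fps_X ^ (i - 1) * ?Q ^ (4 * i)) $ n)"
    by (intro sum.cong) (auto simp: T simp del: One_nat_def)
  also have "\<dots> = (\<Sum>i = 1..n + 1. of_int (yy \<alpha> i) * (fps_X ^ (i - 1) * ?Q ^ (4 * i)) $ n)"
    by (intro sum.mono_neutral_right) (auto simp: N_def fps_X_power_mult_nth)
  finally show "a9 (3 ^ (\<alpha> + 1) * n + 3 ^ (\<alpha> + 1) - 1) =
    (\<Sum>i = 1..n + 1. of_int (yy \<alpha> i) * (fps_X ^ (i - 1) * ?Q ^ (4 * i)) $ n)" .
qed

end
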